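(* Let $\theta\in\mathbb R\setminus\mathbb Q$ be arbitrary, and let $\alpha$ be a concave modulus, differentiable on $(0,\infty)$, such that \[\int_0^1\frac{\alpha^{-1}(t)}{t^2}\,dt<\infty\qquad\text{and}\qquad \sup_{t>0}\frac{\alpha(t)}{t\,\alpha'(t)}<\infty.\] Then there exists an exceptional diffeomorphism $f\in\mathrm{Diff}_+^{1,\alpha}(S^1)$ with rotation number $\theta$ (mod $1$), with a maximal wandering set $\{J_i\}_{i\in\mathbb Z}$ whose lengths $\ell_i=|J_i|$ satisfy $\ell_{i+1}/\ell_i\to 1$ as $i\to\infty$.
   Context: $S^1=\mathbb R/\mathbb Z$, and $|x-y|$ for $x,y\in S^1$ is the distance modulo $1$. A concave modulus is a homeomorphism $\alpha\colon[0,\infty)\to[0,\infty)$ that is concave; $\alpha^{-1}$ is its inverse function. A function $g\colon S^1\to\mathbb R$ is $\alpha$-continuous if $\sup_{x\neq y}|g(x)-g(y)|/\alpha(|x-y|)<\infty$. $\mathrm{Diff}_+^{1,\alpha}(S^1)$ is the group of orientation-preserving $C^1$ diffeomorphisms of $S^1$ with $\alpha$-continuous derivative. An exceptional diffeomorphism is one with irrational rotation number having an exceptional minimal set $K$, i.e. a minimal closed invariant set homeomorphic to a Cantor set. A maximal wandering set for $f$ is a family $\{J_i\}_{i\in\mathbb Z}$ of pairwise disjoint open intervals in $S^1\setminus K$ with $f(J_i)=J_{i+1}$ for all $i$, such that any interval properly containing some $J_i$ meets $K$ (so the family is the $f$-orbit of one connected component of $S^1\setminus K$). *)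

theory Defs
  imports "HOL-Analysis.Analysis"
begin

section \<open>The circle\<close>

quotient_type circle = real / "\<lambda>x y. x - y \<in> \<int>"
  morphisms rep_circle circle_of
proof (rule equivpI)
  show "reflp (\<lambda>x y::real. x - y \<in> \<int>)"
    by (simp add: reflp_def)
  show "symp (\<lambda>x y::real. x - y \<in> \<int>)"
    by (metis (no_types, lifting) Ints_minus minus_diff_eq sympI)
  show "transp (\<lambda>x y::real. x - y \<in> \<int>)"
  proof (rule transpI)
    fix x y z :: real
    assume "x - y \<in> \<int>" "y - z \<in> \<int>"
    then have "(x - y) + (y - z) \<in> \<int>" by (rule Ints_add)
    then show "x - z \<in> \<int>" by simp
  qed
qed

lemma circle_of_eq_iff: "circle_of x = circle_of y \<longleftrightarrow> x - y \<in> \<int>"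
  by (rule circle.abs_eq_iff)

text \<open>The distance from a real number to the nearest integer.\<close>

definition int_dist :: "real \<Rightarrow> real" where
  "int_dist z = \<bar>z - of_int (round z)\<bar>"

lemma int_dist_le: "int_dist z \<le> \<bar>z - of_int m\<bar>"
  unfolding int_dist_def by (rule round_diff_minimal)

lemma int_dist_add_Ints_le:
  assumes "k \<in> \<int>"
  shows "int_dist (z + k) \<le> int_dist z"
proof -
  obtain m where m: "k = of_int m" using assms by (auto elim: Ints_cases)
  have "int_dist (z + k) \<le> \<bar>z + k - of_int (round z + m)\<bar>" by (rule int_dist_le)
  then show ?thesis by (simp add: int_dist_def m)
qed

lemma int_dist_cong:
  assumes "z - w \<in> \<int>"
  shows "int_dist z = int_dist w"
proof (rule antisym)
  show "int_dist z \<le> int_dist w"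
    using int_dist_add_Ints_le[OF assms, of w] by simp
  have "w - z \<in> \<int>" using Ints_minus[OF assms] by simp
  from int_dist_add_Ints_le[OF this, of z] show "int_dist w \<le> int_dist z" by simp
qed

lemma int_dist_triangle: "int_dist (z + w) \<le> int_dist z + int_dist w"
proof -
  have "int_dist (z + w) \<le> \<bar>z + w - of_int (round z + round w)\<bar>" by (rule int_dist_le)
  also have "\<dots> \<le> int_dist z + int_dist w" unfolding int_dist_def by simp
  finally show ?thesis .
qed

lemma int_dist_minus_le: "int_dist (- z) \<le> int_dist z"
proof -
  have "int_dist (- z) \<le> \<bar>- z - of_int (- round z)\<bar>" by (rule int_dist_le)
  then show ?thesis by (simp add: int_dist_def)
qed

lemma int_dist_eq_0_iff: "int_dist z = 0 \<longleftrightarrow> z \<in> \<int>"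
proof
  assume "int_dist z = 0"
  then have "z = of_int (round z)" by (simp add: int_dist_def)
  then show "z \<in> \<int>" by (metis Ints_of_int)
qed (auto simp: int_dist_def elim: Ints_cases)

instantiation circle :: metric_space
begin

lift_definition dist_circle :: "circle \<Rightarrow> circle \<Rightarrow> real" is "\<lambda>x y. int_dist (x - y)"
proof -
  fix x x' y y' :: real
  assume "x - x' \<in> \<int>" "y - y' \<in> \<int>"
  then have "(x - x') - (y - y') \<in> \<int>" by (rule Ints_diff)
  then have "(x - y) - (x' - y') \<in> \<int>" by (simp add: algebra_simps)
  then show "int_dist (x - y) = int_dist (x' - y')" by (rule int_dist_cong)
qed

definition uniformity_circle :: "(circle \<times> circle) filter" where
  "uniformity_circle = (INF e\<in>{0<..}. principal {(x, y). dist x y < e})"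

definition open_circle :: "circle set \<Rightarrow> bool" where
  "open_circle U \<longleftrightarrow> (\<forall>x\<in>U. eventually (\<lambda>(x', y). x' = x \<longrightarrow> y \<in> U) uniformity)"

instance
proof
  fix x y z :: circle
  show "dist x y = 0 \<longleftrightarrow> x = y"
    by transfer (rule int_dist_eq_0_iff)
  show "dist x y \<le> dist x z + dist y z"
  proof transfer
    fix x y z :: real
    have "int_dist (x - y) \<le> int_dist (x - z) + int_dist (z - y)"
      using int_dist_triangle[of "x - z" "z - y"] by simp
    also have "int_dist (z - y) \<le> int_dist (y - z)"
      using int_dist_minus_le[of "y - z"] by simp
    finally show "int_dist (x - y) \<le> int_dist (x - z) + int_dist (y - z)" by simp
  qed
qed (simp_all add: uniformity_circle_def open_circle_def)

end

text \<open>The length of a measurable subset of the circle; for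
  \<open>circle_of ` {a<..<b}\<close> with \<open>a \<le> b \<le> a + 1\<close> it is \<open>b - a\<close>.\<close>

definition circle_length :: "circle set \<Rightarrow> real" where
  "circle_length A = measure lborel {x \<in> {0..<1}. circle_of x \<in> A}"

definition circle_interval :: "circle set \<Rightarrow> bool" where
  "circle_interval I \<longleftrightarrow> (\<exists>A::real set. is_interval A \<and> I = circle_of ` A)"

definition open_circle_interval :: "circle set \<Rightarrow> bool" where
  "open_circle_interval I \<longleftrightarrow> (\<exists>a b::real. a < b \<and> b \<le> a + 1 \<and> I = circle_of ` {a<..<b})"

section \<open>Moduli of continuity\<close>

text \<open>A modulus is a function on \<open>[0,\<infinity>)\<close>; its values at negative arguments are irrelevant.\<close>

definition concave_modulus :: "(real \<Rightarrow> real) \<Rightarrow> bool" where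
  "concave_modulus \<alpha> \<longleftrightarrow> (\<exists>\<beta>. homeomorphism {0..} {0..} \<alpha> \<beta>) \<and> concave_on {0..} \<alpha>"

definition modulus_inv :: "(real \<Rightarrow> real) \<Rightarrow> real \<Rightarrow> real" where
  "modulus_inv \<alpha> = inv_into {0..} \<alpha>"

definition alpha_continuous :: "(real \<Rightarrow> real) \<Rightarrow> (circle \<Rightarrow> real) \<Rightarrow> bool" where
  "alpha_continuous \<alpha> g \<longleftrightarrow> bdd_above {\<bar>g x - g y\<bar> / \<alpha> (dist x y) | x y. x \<noteq> y}"

section \<open>Diffeomorphisms of the circle\<close>

definition lift_of :: "(real \<Rightarrow> real) \<Rightarrow> (circle \<Rightarrow> circle) \<Rightarrow> bool" where
  "lift_of F f \<longleftrightarrow> continuous_on UNIV F \<and> (\<forall>x. f (circle_of x) = circle_of (F x))"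

definition orientation_preserving :: "(circle \<Rightarrow> circle) \<Rightarrow> bool" where
  "orientation_preserving f \<longleftrightarrow> (\<exists>F. lift_of F f \<and> strict_mono F)"

text \<open>Two lifts of the same map differ by a constant integer, and \<open>F (x + 1) - F x\<close> is a
  constant integer for each lift \<open>F\<close>, so \<open>D\<close> depends neither on the lift nor on the
  representative of the point.\<close>

definition has_circle_derivative :: "(circle \<Rightarrow> circle) \<Rightarrow> real \<Rightarrow> circle \<Rightarrow> bool" where
  "has_circle_derivative f D p \<longleftrightarrow>
     (\<exists>F x. lift_of F f \<and> circle_of x = p \<and> (F has_real_derivative D) (at x))"

definition C1_with_derivative :: "(circle \<Rightarrow> circle) \<Rightarrow> (circle \<Rightarrow> real) \<Rightarrow> bool" where
  "C1_with_derivative f f' \<longleftrightarrow>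
     continuous_on UNIV f' \<and> (\<forall>p. has_circle_derivative f (f' p) p)"

definition Diff_plus_1 :: "(real \<Rightarrow> real) \<Rightarrow> (circle \<Rightarrow> circle) set" where
  "Diff_plus_1 \<alpha> = {f. bij f \<and> orientation_preserving f \<and>
     (\<exists>f'. C1_with_derivative f f' \<and> alpha_continuous \<alpha> f') \<and>
     (\<exists>h'. C1_with_derivative (inv f) h')}"

section \<open>Dynamics\<close>

text \<open>The translation number depends on the choice of the lift \<open>F\<close>; changing \<open>F\<close> adds an
  integer. So the following holds for exactly the real numbers \<open>\<rho>\<close> in one class mod 1.\<close>

definition has_rotation_number :: "(circle \<Rightarrow> circle) \<Rightarrow> real \<Rightarrow> bool" where
  "has_rotation_number f \<rho> \<longleftrightarrow>
     (\<exists>F. lift_of F f \<and> strict_mono F \<and> (\<forall>x. (\<lambda>n. (F ^^ n) x / real n) \<longlonglongrightarrow> \<rho>))"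

definition minimal_set :: "(circle \<Rightarrow> circle) \<Rightarrow> circle set \<Rightarrow> bool" where
  "minimal_set f K \<longleftrightarrow> K \<noteq> {} \<and> closed K \<and> f ` K = K \<and>
     (\<forall>M. M \<subseteq> K \<and> M \<noteq> {} \<and> closed M \<and> f ` M = M \<longrightarrow> M = K)"

text \<open>The model of the Cantor set is \<open>{0,1}\<^sup>\<nat>\<close> with the product topology.\<close>

definition exceptional_minimal_set :: "(circle \<Rightarrow> circle) \<Rightarrow> circle set \<Rightarrow> bool" where
  "exceptional_minimal_set f K \<longleftrightarrow>
     minimal_set f K \<and> K homeomorphic (UNIV :: (nat \<Rightarrow> bool) set)"

definition exceptional :: "(circle \<Rightarrow> circle) \<Rightarrow> bool" where
  "exceptional f \<longleftrightarrow> (\<exists>\<rho>. \<rho> \<notin> \<rat> \<and> has_rotation_number f \<rho>) \<and>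
     (\<exists>K. exceptional_minimal_set f K)"

definition maximal_wandering_set ::
    "(circle \<Rightarrow> circle) \<Rightarrow> circle set \<Rightarrow> (int \<Rightarrow> circle set) \<Rightarrow> bool" where
  "maximal_wandering_set f K J \<longleftrightarrow>
     (\<forall>i. open_circle_interval (J i) \<and> J i \<subseteq> - K) \<and>
     (\<forall>i j. i \<noteq> j \<longrightarrow> J i \<inter> J j = {}) \<and>
     (\<forall>i. f ` J i = J (i + 1)) \<and>
     (\<forall>i I. circle_interval I \<and> J i \<subset> I \<longrightarrow> I \<inter> K \<noteq> {})"

end

theory Submission
  imports Defs
begin

text \<open>This is Denjoy's construction. The gap lengths are \<open>l i = \<alpha>\<^sup>-\<^sup>1 (1 / (\<bar>i\<bar> + N))\<close> for a
  large \<open>N\<close>. The integral condition makes them summable, with sum less than \<open>1\<close>. The condition on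
  \<open>\<alpha> t / (t * \<alpha>' t)\<close> bounds the growth of \<open>\<alpha>\<^sup>-\<^sup>1\<close> by a power, so
  \<open>\<bar>l (i + 1) / l i - 1\<bar> \<le> C / (\<bar>i\<bar> + N) = C * \<alpha> (l i)\<close> for some constant \<open>C\<close>.

  Each point \<open>i * \<theta>\<close> of an orbit of the rotation is replaced by an interval of length \<open>l i\<close>, and the
  rest of the circle keeps positive total length. The diffeomorphism has derivative \<open>1\<close> outside the
  gaps and \<open>1 + (l (i + 1) / l i - 1) * bump\<close> on the \<open>i\<close>-th gap. Written as a sum over \<open>i\<close> of explicit
  \<open>C\<^sup>1\<close> functions, its lift can be differentiated termwise, because the derivatives of the summands
  have disjoint supports and sup norms tending to \<open>0\<close>; and it moves the ends of the blown-up points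
  by the rotation, term by term. A bump on a gap of length \<open>l i\<close> and height \<open>C * \<alpha> (l i)\<close> is
  \<open>\<alpha>\<close>-continuous with a uniform constant since \<open>\<alpha> t / t\<close> is nonincreasing.\<close>

text \<open>Since \<open>l i\<close> tends to 0, the logarithms of the ratios
  \<open>l (i + 1) / l i\<close> are not absolutely summable, and neither are the sup norms of the
  derivative terms. The M-test is therefore out of reach, and uniform convergence has to come from
  the fact that the gaps are disjoint. The formula of the lift comes from the blow-up coordinate. A
  blown-up point sits at \<open>slack * x\<close> plus the sum over \<open>i\<close> of
  \<open>l i\<close> times a count of the translates of \<open>i * \<theta>\<close> to its left.
  Rotating by \<theta> turns the count of index \<open>i\<close> into that of index
  \<open>i + 1\<close>, so the map only has to replace the weight \<open>l i\<close> of each count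
  by \<open>l (i + 1)\<close>. Once each counting function is made a C^1 staircase that rises across
  its own gaps, this is one formula on the whole line, and nothing has to be glued between the gaps
  and their complement or extended from an orbit by continuity.\<close>

subsection \<open>A characterization of the Cantor space\<close>

text \<open>\<open>homeomorphic_compact\<close> does not apply directly: the library has no \<open>t2_space\<close>
  instance for \<open>nat \<Rightarrow> bool\<close>, so the map is routed through \<open>nat \<Rightarrow> real\<close>.\<close>

lemma homeomorphic_compact_bool_fun:
  fixes f :: "'a::topological_space \<Rightarrow> nat \<Rightarrow> bool"
  assumes "compact S" "inj_on f S" "f ` S = UNIV" "continuous_on S f"
  shows "S homeomorphic (UNIV :: (nat \<Rightarrow> bool) set)"
proof -
  define e :: "(nat \<Rightarrow> bool) \<Rightarrow> nat \<Rightarrow> real" where "e = (\<lambda>b n. of_bool (b n))"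
  define r :: "(nat \<Rightarrow> real) \<Rightarrow> nat \<Rightarrow> bool" where "r = (\<lambda>\<psi> n. \<psi> n = 1)"
  have re: "r (e b) = b" for b by (auto simp: r_def e_def)
  have e: "continuous_on UNIV e"
    unfolding e_def
  proof (rule continuous_on_coordinatewise_then_product)
    fix n :: nat
    have "continuous_on UNIV (of_bool :: bool \<Rightarrow> real)"
      by simp
    from continuous_on_compose2[OF this continuous_on_product_coordinates[of n]]
    show "continuous_on UNIV (\<lambda>b::nat \<Rightarrow> bool. of_bool (b n) :: real)" by simp
  qed
  have r: "continuous_on (range e) r"
    unfolding r_def
  proof (rule continuous_on_coordinatewise_then_product)
    fix n :: nat
    have "continuous_on {0, 1::real} (\<lambda>x. x = 1)"
      by (rule continuous_on_finite) simp
    then show "continuous_on (range e) (\<lambda>\<psi>. \<psi> n = 1)"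
      by (rule continuous_on_compose2[OF _ continuous_on_subset[OF continuous_on_product_coordinates]])
        (auto simp: e_def)
  qed
  have "homeomorphism UNIV (range e) e r"
    using e r re by (auto simp: homeomorphism_def image_image)
  then have "range e homeomorphic (UNIV :: (nat \<Rightarrow> bool) set)"
    using homeomorphic_def homeomorphic_sym by blast
  moreover have "S homeomorphic range e"
  proof (rule homeomorphic_compact)
    show "continuous_on S (\<lambda>x. e (f x))"
      using continuous_on_compose2[OF e assms(4)] by simp
    show "(\<lambda>x. e (f x)) ` S = range e" using assms(3) by (metis image_image)
    show "inj_on (\<lambda>x. e (f x)) S" using assms(2) re by (metis inj_on_def)
  qed fact
  ultimately show ?thesis using homeomorphic_trans by blast
qed

definition splits :: "'a set \<Rightarrow> 'a set \<Rightarrow> bool" where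
  "splits B A \<longleftrightarrow> A \<inter> B \<noteq> {} \<and> A - B \<noteq> {}"

definition split_index :: "(nat \<Rightarrow> 'a set) \<Rightarrow> 'a set \<Rightarrow> nat" where
  "split_index U A = (LEAST n. splits (U n) A)"

primrec split_node :: "'a set \<Rightarrow> (nat \<Rightarrow> 'a set) \<Rightarrow> (nat \<Rightarrow> bool) \<Rightarrow> nat \<Rightarrow> 'a set" where
  "split_node S U b 0 = S"
| "split_node S U b (Suc n) =
     (if b n then split_node S U b n \<inter> U (split_index U (split_node S U b n))
      else split_node S U b n - U (split_index U (split_node S U b n)))"

text \<open>The branch of the tree that contains \<open>x\<close>. It is defined on its own because
  the code of \<open>x\<close> is read off from it: bit \<open>n\<close> of
  \<open>split_code\<close> asks on which side of the splitting set of the node at depth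
  \<open>n\<close> the point lies.\<close>

primrec point_node :: "'a set \<Rightarrow> (nat \<Rightarrow> 'a set) \<Rightarrow> 'a \<Rightarrow> nat \<Rightarrow> 'a set" where
  "point_node S U x 0 = S"
| "point_node S U x (Suc n) =
     (if x \<in> U (split_index U (point_node S U x n))
      then point_node S U x n \<inter> U (split_index U (point_node S U x n))
      else point_node S U x n - U (split_index U (point_node S U x n)))"

definition split_code :: "'a set \<Rightarrow> (nat \<Rightarrow> 'a set) \<Rightarrow> 'a \<Rightarrow> nat \<Rightarrow> bool" where
  "split_code S U x n \<longleftrightarrow> x \<in> U (split_index U (point_node S U x n))"

lemma split_node_code: "split_node S U (split_code S U x) n = point_node S U x n"
  by (induction n) (auto simp: split_code_def)

lemma in_point_node: "x \<in> S \<Longrightarrow> x \<in> point_node S U x n"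
  by (induction n) auto

lemma point_node_eq:
  "(\<And>m. x \<in> split_node S U b m) \<Longrightarrow> point_node S U x n = split_node S U b n"
proof (induction n)
  case (Suc n)
  from Suc.prems[of "Suc n"] show ?case
    using Suc by (auto split: if_splits)
qed simp

lemma split_code_eq:
  assumes "\<And>m. x \<in> split_node S U b m"
  shows "split_code S U x = b"
proof
  fix n
  from assms[of "Suc n"] show "split_code S U x n = b n"
    using point_node_eq[of x S U b n] assms
    by (auto simp: split_code_def split: if_splits)
qed

text \<open>A nonempty clopen set is always split by the first \<open>U n\<close> that splits it, so the splitting index
  increases strictly along a branch of the resulting binary tree. Hence two points separated by
  \<open>U m\<close> are in different nodes after at most \<open>m + 1\<close> steps.\<close>

theorem homeomorphic_Cantor_space:
  fixes S :: "'a::t2_space set" and U :: "nat \<Rightarrow> 'a set"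
  assumes S: "compact S" "S \<noteq> {}"
    and cl: "\<And>n. closedin (top_of_set S) (S \<inter> U n)"
    and op: "\<And>n. openin (top_of_set S) (S \<inter> U n)"
    and sep: "\<And>x y. x \<in> S \<Longrightarrow> y \<in> S \<Longrightarrow> x \<noteq> y \<Longrightarrow> \<exists>n. (x \<in> U n) \<noteq> (y \<in> U n)"
    and perf: "\<And>x V. openin (top_of_set S) V \<Longrightarrow> x \<in> V \<Longrightarrow> \<exists>y\<in>V. y \<noteq> x"
  shows "S homeomorphic (UNIV :: (nat \<Rightarrow> bool) set)"
proof -
  let ?T = "top_of_set S"
  have splits: "splits (U (split_index U A)) A" if A: "openin ?T A" "A \<noteq> {}" for A
  proof -
    obtain x where x: "x \<in> A" using A by auto
    obtain y where y: "y \<in> A" "y \<noteq> x" using perf[OF A(1) x] by auto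
    have "A \<subseteq> S" using A openin_imp_subset by blast
    then obtain n where "(x \<in> U n) \<noteq> (y \<in> U n)" using sep x y by blast
    then have "splits (U n) A" using x y by (auto simp: splits_def)
    then show ?thesis unfolding split_index_def by (rule LeastI)
  qed
  have node: "openin ?T (split_node S U b n) \<and> closedin ?T (split_node S U b n)
      \<and> split_node S U b n \<noteq> {}" for b n
  proof (induction n)
    case (Suc n)
    let ?A = "split_node S U b n" and ?i = "split_index U (split_node S U b n)"
    have sub: "?A \<subseteq> S" using Suc openin_imp_subset by blast
    have "openin ?T (?A \<inter> (S \<inter> U ?i))" "closedin ?T (?A \<inter> (S \<inter> U ?i))"
      "openin ?T (?A - (S \<inter> U ?i))" "closedin ?T (?A - (S \<inter> U ?i))"
      using Suc cl op by (simp_all add: openin_Int closedin_Int openin_diff closedin_diff)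
    moreover have "?A \<inter> (S \<inter> U ?i) = ?A \<inter> U ?i" "?A - (S \<inter> U ?i) = ?A - U ?i"
      using sub by auto
    moreover have "splits (U ?i) ?A" using splits Suc by blast
    ultimately show ?case by (auto simp: splits_def)
  qed (use S in auto)
  have idx: "n \<le> split_index U (split_node S U b n)" for b n
  proof (induction n)
    case (Suc n)
    let ?A = "split_node S U b n" and ?A' = "split_node S U b (Suc n)"
    have s: "splits (U (split_index U ?A')) ?A'" using splits node by blast
    have "?A' \<subseteq> ?A" by auto
    then have "splits (U (split_index U ?A')) ?A" using s unfolding splits_def by blast
    then have le: "split_index U ?A \<le> split_index U ?A'"
      by (subst split_index_def) (rule Least_le)
    \<comment> \<open>A child lies entirely inside or entirely outside the set just used, so that
      set cannot split it again.\<close>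
    have "\<not> splits (U (split_index U ?A)) ?A'" by (auto simp: splits_def)
    with s have "split_index U ?A \<noteq> split_index U ?A'" by metis
    with le Suc show ?case by linarith
  qed simp
  have "inj_on (split_code S U) S"
  proof (rule inj_onI, rule ccontr)
    fix x y assume xy: "x \<in> S" "y \<in> S" "split_code S U x = split_code S U y" "x \<noteq> y"
    obtain m where m: "(x \<in> U m) \<noteq> (y \<in> U m)" using sep xy by blast
    let ?A = "split_node S U (split_code S U x) (Suc m)"
    have "x \<in> ?A" "y \<in> ?A"
      using in_point_node[OF xy(1), of U "Suc m"] in_point_node[OF xy(2), of U "Suc m"] xy(3)
      by (metis split_node_code)+
    then have "splits (U m) ?A" using m by (auto simp only: splits_def)
    then have "split_index U ?A \<le> m" unfolding split_index_def by (rule Least_le)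
    with idx[of "Suc m" "split_code S U x"] show False by linarith
  qed
  moreover have "split_code S U ` S = UNIV"
  proof -
    have "\<exists>x\<in>S. split_code S U x = b" for b
    proof -
      have "compact (split_node S U b n)" for n
        using node S(1) closedin_compact by blast
      have dec: "split_node S U b n \<subseteq> split_node S U b m" if "m \<le> n" for m n
        using that by (induction rule: dec_induct) auto
      have "S \<inter> (\<Inter>n. split_node S U b n) \<noteq> {}"
        proof (rule compact_imp_fip_image[OF S(1)])
          show "closed (split_node S U b i)" for i
            using \<open>\<And>n. compact (split_node S U b n)\<close> compact_imp_closed by blast
          fix I :: "nat set" assume I: "finite I"
          have "split_node S U b (Max (insert 0 I)) \<subseteq> split_node S U b i" if "i \<in> I" for i
            using I that by (intro dec Max_ge) auto
          moreover have "split_node S U b (Max (insert 0 I)) \<subseteq> S"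
            using node openin_imp_subset by blast
          ultimately have "split_node S U b (Max (insert 0 I)) \<subseteq> S \<inter> (\<Inter>i\<in>I. split_node S U b i)"
            by blast
          then show "S \<inter> (\<Inter>i\<in>I. split_node S U b i) \<noteq> {}" using node by blast
      qed
      then obtain x where x: "\<And>n. x \<in> split_node S U b n" by auto
      from x[of 0] split_code_eq[OF x] show ?thesis by auto
    qed
    then show ?thesis by (metis (no_types, lifting) UNIV_eq_I imageI)
  qed
  moreover have "continuous_on S (split_code S U)"
  proof (rule continuous_on_coordinatewise_then_product)
    fix n
    show "continuous_on S (\<lambda>x. split_code S U x n)"
    proof (subst continuous_openin_preimage_eq, intro allI impI)
      fix B :: "bool set"
      have "\<exists>A. openin ?T A \<and> x \<in> A \<and> A \<subseteq> S \<inter> (\<lambda>x. split_code S U x n) -` B"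
        if x: "x \<in> S \<inter> (\<lambda>x. split_code S U x n) -` B" for x
      proof -
        have same: "point_node S U y m = point_node S U x m"
          if "y \<in> point_node S U x m" for y m
          using that
        proof (induction m)
          case (Suc m)
          then have "y \<in> point_node S U x m" by (auto split: if_splits)
          with Suc show ?case by (auto split: if_splits)
        qed simp
        have op: "openin ?T (point_node S U x (Suc n))"
          using node split_node_code by metis
        have "split_code S U y n = split_code S U x n" if "y \<in> point_node S U x (Suc n)" for y
        proof -
          have "point_node S U y n = point_node S U x n" using that same by (auto split: if_splits)
          then show ?thesis using that by (auto simp: split_code_def split: if_splits)
        qed
        then have "point_node S U x (Suc n) \<subseteq> S \<inter> (\<lambda>x. split_code S U x n) -` B"
          using x openin_imp_subset[OF op] by (auto simp del: point_node.simps)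
        moreover have "x \<in> point_node S U x (Suc n)" using x by (blast intro: in_point_node)
        ultimately show ?thesis using op by blast
      qed
      then show "openin ?T (S \<inter> (\<lambda>x. split_code S U x n) -` B)"
        by (subst openin_subopen) blast
    qed
  qed
  ultimately show ?thesis
    by (rule homeomorphic_compact_bool_fun[OF S(1)])
qed

subsection \<open>Concave moduli and gap lengths\<close>

text \<open>Once decreasing, a concave function stays below a falling line and becomes negative, but
  the values here are nonnegative. So \<open>\<alpha>\<close> is monotone, and injectivity makes it
  strictly so.\<close>

lemma concave_modulus_strict_mono:
  assumes "concave_modulus \<alpha>"
  shows "strict_mono_on {0..} \<alpha>"
proof -
  obtain \<beta> where hom: "homeomorphism {0..} {0..} \<alpha> \<beta>" and conc: "concave_on {0..} \<alpha>"
    using assms by (auto simp: concave_modulus_def)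
  have nonneg: "0 \<le> \<alpha> x" if "0 \<le> x" for x
    using homeomorphism_image1[OF hom] that by (metis atLeast_iff imageI)
  have inj: "inj_on \<alpha> {0..}"
    using homeomorphism_apply1[OF hom] by (rule inj_on_inverseI)
  have le: "\<alpha> s \<le> \<alpha> t" if "0 \<le> s" "s < t" for s t
  proof (rule ccontr)
    assume "\<not> \<alpha> s \<le> \<alpha> t"
    then have lt: "\<alpha> t < \<alpha> s" by simp
    have as: "0 \<le> \<alpha> t" "0 < \<alpha> s" using nonneg[of t] that lt by auto
    \<comment> \<open>The weight for which \<open>(1 - c) * \<alpha> s\<close> is the mean of
      \<open>\<alpha> s\<close> and \<open>\<alpha> t\<close>, still above
      \<open>\<alpha> t\<close>. The point \<open>u\<close> is placed so that \<open>t\<close> is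
      the combination of \<open>s\<close> and \<open>u\<close> with weight \<open>c\<close> on
      \<open>u\<close>.\<close>
    define c where "c = (\<alpha> s - \<alpha> t) / (2 * \<alpha> s)"
    have c: "0 < c" "c \<le> 1" using as lt by (auto simp: c_def)
    define u where "u = s + (t - s) / c"
    have "0 < (t - s) / c" using that c by simp
    then have u: "0 \<le> u" using that by (simp add: u_def)
    have "(1 - c) *\<^sub>R s + c *\<^sub>R u = t" using c by (simp add: u_def field_simps)
    moreover have "(1 - c) * \<alpha> s + c * \<alpha> u \<le> \<alpha> ((1 - c) *\<^sub>R s + c *\<^sub>R u)"
      by (rule concave_onD[OF conc]) (use c u that in auto)
    moreover have "0 \<le> c * \<alpha> u" using c nonneg[OF u] by simp
    ultimately have "(1 - c) * \<alpha> s \<le> \<alpha> t" by simp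
    moreover have "c * \<alpha> s = (\<alpha> s - \<alpha> t) / 2" using as by (simp add: c_def)
    moreover have "(1 - c) * \<alpha> s = \<alpha> s - c * \<alpha> s" by (simp add: algebra_simps)
    ultimately have "\<alpha> s - (\<alpha> s - \<alpha> t) / 2 \<le> \<alpha> t" by simp
    then show False using lt by (simp add: field_simps)
  qed
  show ?thesis
  proof (rule strict_mono_onI)
    fix s t :: real assume "s \<in> {0..}" "t \<in> {0..}" "s < t"
    then have "\<alpha> s \<le> \<alpha> t" "\<alpha> s \<noteq> \<alpha> t" using le inj by (auto simp: inj_on_eq_iff)
    then show "\<alpha> s < \<alpha> t" by simp
  qed
qed

lemma concave_modulus_zero:
  assumes "concave_modulus \<alpha>"
  shows "\<alpha> 0 = 0"
proof -
  have im: "\<alpha> ` {0..} = {0..}"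
    using assms by (auto simp: concave_modulus_def homeomorphism_def)
  then have "0 \<in> \<alpha> ` {0..}" by simp
  then obtain x where x: "0 \<le> x" "\<alpha> x = 0" by (metis atLeast_iff imageE)
  have "0 \<le> \<alpha> 0" using im by force
  then show ?thesis
    using x strict_mono_onD[OF concave_modulus_strict_mono[OF assms], of 0 x]
    by (cases "x = 0") auto
qed

lemma concave_modulus_pos:
  assumes "concave_modulus \<alpha>" "0 < t"
  shows "0 < \<alpha> t"
  using strict_mono_onD[OF concave_modulus_strict_mono[OF assms(1)], of 0 t]
    concave_modulus_zero[OF assms(1)] assms(2) by simp

lemma concave_modulus_mono:
  assumes "concave_modulus \<alpha>" "0 \<le> s" "s \<le> t"
  shows "\<alpha> s \<le> \<alpha> t"
  using strict_mono_onD[OF concave_modulus_strict_mono[OF assms(1)], of s t] assms(2,3)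
  by (cases "s = t") auto

text \<open>Concavity on the segment from 0 to \<open>t\<close>, as \<open>\<alpha>\<close> vanishes
  at 0. It converts Lipschitz bounds at scales below \<open>l i\<close> into bounds by the
  modulus.\<close>

lemma concave_modulus_scale:
  assumes "concave_modulus \<alpha>" "0 \<le> s" "s \<le> t" "0 < t"
  shows "s / t * \<alpha> t \<le> \<alpha> s"
proof -
  have "concave_on {0..} \<alpha>" using assms(1) by (simp add: concave_modulus_def)
  from concave_onD[OF this, of "s / t" 0 t] show ?thesis
    using assms concave_modulus_zero[OF assms(1)] by simp
qed

lemma modulus_inv_right:
  assumes "concave_modulus \<alpha>" "0 \<le> s"
  shows "\<alpha> (modulus_inv \<alpha> s) = s" "0 \<le> modulus_inv \<alpha> s"
proof -
  have "\<alpha> ` {0..} = {0..}"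
    using assms by (auto simp: concave_modulus_def homeomorphism_def)
  then have s: "s \<in> \<alpha> ` {0..}" using assms(2) by simp
  show "\<alpha> (modulus_inv \<alpha> s) = s"
    unfolding modulus_inv_def by (rule f_inv_into_f[OF s])
  show "0 \<le> modulus_inv \<alpha> s"
    using inv_into_into[OF s] by (simp add: modulus_inv_def)
qed

lemma modulus_inv_pos:
  assumes "concave_modulus \<alpha>" "0 < s"
  shows "0 < modulus_inv \<alpha> s"
proof -
  have "modulus_inv \<alpha> s \<noteq> 0"
    using modulus_inv_right(1)[OF assms(1), of s] concave_modulus_zero[OF assms(1)] assms(2)
    by auto
  with modulus_inv_right(2)[OF assms(1), of s] assms(2) show ?thesis by simp
qed

lemma modulus_inv_mono:
  assumes "concave_modulus \<alpha>" "0 \<le> s" "s \<le> t"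
  shows "modulus_inv \<alpha> s \<le> modulus_inv \<alpha> t"
proof (rule ccontr)
  assume "\<not> ?thesis"
  then have "\<alpha> (modulus_inv \<alpha> t) < \<alpha> (modulus_inv \<alpha> s)"
    using strict_mono_onD[OF concave_modulus_strict_mono[OF assms(1)]]
      modulus_inv_right(2)[OF assms(1)] assms by simp
  with assms show False by (simp add: modulus_inv_right)
qed

text \<open>The tangent at \<open>t\<close> lies above the graph, so \<open>D * t\<close> is at
  least \<open>\<alpha> (2 * t) - \<alpha> t\<close>, which is positive. The sign serves to clear
  the denominator in the hypothesis on \<open>\<alpha> t / (t * deriv \<alpha> t)\<close>.\<close>

lemma concave_modulus_deriv_pos:
  assumes \<alpha>: "concave_modulus \<alpha>" and d: "(\<alpha> has_real_derivative D) (at t)" and t: "0 < t"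
  shows "0 < D"
proof -
  have "convex_on {0..} (\<lambda>x. - \<alpha> x)"
    using \<alpha> by (simp add: concave_modulus_def concave_on_def)
  moreover have "((\<lambda>x. - \<alpha> x) has_real_derivative - D) (at t within {0..})"
    by (rule DERIV_minus[OF has_field_derivative_at_within[OF d]])
  ultimately have "- \<alpha> (2 * t) - - \<alpha> t \<ge> - D * (2 * t - t)"
    using t by (intro convex_on_imp_above_tangent[where A = "{0..}"]) (auto simp: connected_Ici)
  moreover have "\<alpha> t < \<alpha> (2 * t)"
    using strict_mono_onD[OF concave_modulus_strict_mono[OF \<alpha>]] t by simp
  ultimately have "0 < D * t" by simp
  then show ?thesis using t by (simp add: zero_less_mult_iff)
qed

text \<open>Integrates \<open>1 / t \<le> M * \<alpha>' t / \<alpha> t\<close> between the two preimages.\<close>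

lemma ln_modulus_inv_le:
  assumes \<alpha>: "concave_modulus \<alpha>"
    and diff: "\<And>t. t > 0 \<Longrightarrow> \<alpha> differentiable (at t)"
    and M: "\<And>t. t > 0 \<Longrightarrow> \<alpha> t / (t * deriv \<alpha> t) \<le> M"
    and s: "0 < s" "s \<le> s'"
  shows "ln (modulus_inv \<alpha> s') - ln (modulus_inv \<alpha> s) \<le> M * (ln s' - ln s)"
proof -
  let ?a = "modulus_inv \<alpha> s" and ?b = "modulus_inv \<alpha> s'"
  have a: "0 < ?a" "?a \<le> ?b"
    using modulus_inv_pos[OF \<alpha>] modulus_inv_mono[OF \<alpha>] s by auto
  have "M * ln (\<alpha> ?a) - ln ?a \<le> M * ln (\<alpha> ?b) - ln ?b"
  proof (rule DERIV_nonneg_imp_nondecreasing[OF a(2)])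
    fix x assume "?a \<le> x" "x \<le> ?b"
    then have x: "0 < x" using a by simp
    have D: "(\<alpha> has_real_derivative deriv \<alpha> x) (at x)"
      using diff[OF x] DERIV_deriv_iff_real_differentiable by blast
    note Dp = concave_modulus_deriv_pos[OF \<alpha> D x]
    have "((\<lambda>x. M * ln (\<alpha> x) - ln x) has_real_derivative
        M * (1 / \<alpha> x * deriv \<alpha> x) - 1 / x) (at x)"
      using x concave_modulus_pos[OF \<alpha> x] D by (auto intro!: derivative_eq_intros)
    moreover have "\<alpha> x \<le> M * (x * deriv \<alpha> x)"
      using M[OF x] x Dp by (simp add: divide_le_eq)
    then have "0 \<le> M * (1 / \<alpha> x * deriv \<alpha> x) - 1 / x"
      using x concave_modulus_pos[OF \<alpha> x] by (simp add: field_simps)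
    ultimately show "\<exists>y. ((\<lambda>x. M * ln (\<alpha> x) - ln x) has_real_derivative y) (at x) \<and> 0 \<le> y"
      by blast
  qed
  then show ?thesis using s by (simp add: modulus_inv_right[OF \<alpha>] algebra_simps)
qed

text \<open>On the piece between \<open>1 / (n + 2)\<close> and \<open>1 / (n + 1)\<close> the
  integrand is at least \<open>b n * (n + 1)\<^sup>2\<close>, and the piece has length
  \<open>1 / ((n + 1) * (n + 2))\<close>, so it contributes at least \<open>b n / 2\<close> to the
  integral.\<close>

lemma modulus_inv_reciprocals_summable:
  assumes \<alpha>: "concave_modulus \<alpha>"
    and int: "(\<integral>\<^sup>+ t\<in>{0<..1}. ennreal (modulus_inv \<alpha> t / t\<^sup>2) \<partial>lborel) < \<infinity>"
  shows "summable (\<lambda>n. modulus_inv \<alpha> (1 / (real n + 2)))"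
proof -
  let ?I = "\<integral>\<^sup>+ t\<in>{0<..1}. ennreal (modulus_inv \<alpha> t / t\<^sup>2) \<partial>lborel"
  define b where "b n = modulus_inv \<alpha> (1 / (real n + 2))" for n :: nat
  define A where "A n = {1 / (real n + 2)<..1 / (real n + 1)}" for n :: nat
  have b: "0 \<le> b n" for n by (simp add: b_def modulus_inv_right[OF \<alpha>])
  have disj: "m = n" if "t \<in> A m" "t \<in> A n" for t m n
  proof -
    have *: "\<not> m < n" if "t \<in> A m" "t \<in> A n" for m n
    proof
      assume "m < n"
      then have "1 / (real n + 1) \<le> 1 / (real m + 2)" by (intro frac_le) auto
      with that show False by (auto simp: A_def)
    qed
    show ?thesis using *[of m n] *[of n m] that by (cases m n rule: linorder_cases) auto
  qed
  have le: "ennreal (b n * (real n + 1)\<^sup>2) \<le> ennreal (modulus_inv \<alpha> t / t\<^sup>2) * indicator {0<..1} t"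
    if t: "t \<in> A n" for t n
  proof -
    have t0: "0 < t" "t \<le> 1" "t \<le> 1 / (real n + 1)" "1 / (real n + 2) \<le> t"
    proof -
      have t': "1 / (real n + 2) < t" "t \<le> 1 / (real n + 1)" using t by (auto simp: A_def)
      have "0 < 1 / (real n + 2)" "1 / (real n + 1) \<le> 1" by simp_all
      with t' show "0 < t" "t \<le> 1" by linarith+
      show "t \<le> 1 / (real n + 1)" "1 / (real n + 2) \<le> t" using t' by simp_all
    qed
    have "real n + 1 \<le> 1 / t" using t0 by (simp add: field_simps)
    then have "(real n + 1)\<^sup>2 \<le> (1 / t)\<^sup>2" by (rule power_mono) simp
    moreover have "b n \<le> modulus_inv \<alpha> t"
      unfolding b_def by (rule modulus_inv_mono[OF \<alpha>]) (use t0 in auto)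
    ultimately have "b n * (real n + 1)\<^sup>2 \<le> modulus_inv \<alpha> t * (1 / t)\<^sup>2"
      using b[of n] by (intro mult_mono) auto
    then show ?thesis using t0 by (simp add: ennreal_leI power_divide)
  qed
  have fin: "ennreal (\<Sum>n\<le>m. b n / 2) \<le> ?I" for m
  proof -
    have "ennreal (\<Sum>n\<le>m. b n / 2) = (\<Sum>n\<le>m. ennreal (b n / 2))"
      by (rule sum_ennreal[symmetric]) (simp add: b)
    also have "\<dots> \<le> (\<Sum>n\<le>m. \<integral>\<^sup>+ t. ennreal (b n * (real n + 1)\<^sup>2) * indicator (A n) t \<partial>lborel)"
    proof (rule sum_mono)
      fix n
      have len: "1 / (real n + 1) - 1 / (real n + 2) = 1 / ((real n + 1) * (real n + 2))"
        by (simp add: field_simps)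
      have "(real n + 1)\<^sup>2 * (1 / ((real n + 1) * (real n + 2))) = (real n + 1) / (real n + 2)"
        by (simp add: power2_eq_square)
      then have "1 / 2 \<le> (real n + 1)\<^sup>2 * (1 / ((real n + 1) * (real n + 2)))"
        by (simp add: le_divide_eq)
      then have "b n * (1 / 2) \<le> b n * ((real n + 1)\<^sup>2 * (1 / ((real n + 1) * (real n + 2))))"
        by (rule mult_left_mono[OF _ b])
      then have "b n / 2 \<le> b n * (real n + 1)\<^sup>2 * (1 / (real n + 1) - 1 / (real n + 2))"
        unfolding len by (simp add: mult.assoc)
      then have "ennreal (b n / 2)
          \<le> ennreal (b n * (real n + 1)\<^sup>2) * ennreal (1 / (real n + 1) - 1 / (real n + 2))"
        by (subst ennreal_mult[symmetric]) (auto simp: b ennreal_leI frac_le)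
      also have "ennreal (1 / (real n + 1) - 1 / (real n + 2)) = emeasure lborel (A n)"
        unfolding A_def by (subst emeasure_lborel_Ioc) (auto simp: frac_le)
      finally show "ennreal (b n / 2)
          \<le> (\<integral>\<^sup>+ t. ennreal (b n * (real n + 1)\<^sup>2) * indicator (A n) t \<partial>lborel)"
        by (subst nn_integral_cmult_indicator) (auto simp: A_def)
    qed
    also have "\<dots> = (\<integral>\<^sup>+ t. (\<Sum>n\<le>m. ennreal (b n * (real n + 1)\<^sup>2) * indicator (A n) t) \<partial>lborel)"
      by (rule nn_integral_sum[symmetric]) (auto simp: A_def)
    also have "\<dots> \<le> ?I"
    proof (rule nn_integral_mono)
      fix t :: real
      show "(\<Sum>n\<le>m. ennreal (b n * (real n + 1)\<^sup>2) * indicator (A n) t)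
          \<le> ennreal (modulus_inv \<alpha> t / t\<^sup>2) * indicator {0<..1} t"
      proof (cases "\<exists>k\<le>m. t \<in> A k")
        case True
        then obtain k where k: "k \<le> m" "t \<in> A k" by auto
        have "(\<Sum>n\<le>m. ennreal (b n * (real n + 1)\<^sup>2) * indicator (A n) t)
            = (\<Sum>n\<le>m. if n = k then ennreal (b k * (real k + 1)\<^sup>2) else 0)"
        proof (rule sum.cong)
          fix n
          have "t \<in> A n \<longleftrightarrow> n = k" using disj k(2) by blast
          then show "ennreal (b n * (real n + 1)\<^sup>2) * indicator (A n) t
              = (if n = k then ennreal (b k * (real k + 1)\<^sup>2) else 0)"
            using k(2) by simp
        qed simp
        then show ?thesis using k le[OF k(2)] by (simp add: sum.delta)
      next
        case False
        then have "(\<Sum>n\<le>m. ennreal (b n * (real n + 1)\<^sup>2) * indicator (A n) t) = 0"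
          by (intro sum.neutral) auto
        then show ?thesis by simp
      qed
    qed
    finally show ?thesis .
  qed
  have "(\<Sum>n\<le>m. b n / 2) \<le> enn2real ?I" for m
  proof -
    have "ennreal (\<Sum>n\<le>m. b n / 2) \<le> ennreal (enn2real ?I)"
      using fin int by (simp add: ennreal_enn2real)
    then show ?thesis by (subst (asm) ennreal_le_iff) auto
  qed
  then have "summable (\<lambda>n. b n / 2)" by (intro bounded_imp_summable) (auto simp: b)
  then have "summable (\<lambda>n. 2 * (b n / 2))" by (rule summable_mult)
  then show ?thesis by (simp add: b_def)
qed

lemma has_sum_int_abs:
  fixes f :: "nat \<Rightarrow> real"
  assumes f: "\<And>n. 0 \<le> f n" "summable f"
  shows "((\<lambda>i::int. f (nat \<bar>i\<bar>)) has_sum (suminf f + (suminf f - f 0))) UNIV"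
proof -
  have 1: "(f has_sum suminf f) UNIV"
    using f by (intro sums_nonneg_imp_has_sum) (auto simp: summable_sums)
  have "(\<lambda>n. f (Suc n)) sums (suminf f - f 0)"
    using f(2) by (simp add: sums_Suc_iff summable_sums)
  then have 2: "((\<lambda>n. f (Suc n)) has_sum (suminf f - f 0)) UNIV"
    using f by (intro sums_nonneg_imp_has_sum) auto
  have i1: "inj int" and i2: "inj (\<lambda>n. - int (Suc n))" by (auto simp: inj_on_def)
  have "((\<lambda>i::int. f (nat \<bar>i\<bar>)) has_sum suminf f) (range int)"
    by (subst has_sum_reindex[OF i1]) (use 1 in \<open>simp add: o_def\<close>)
  moreover have "((\<lambda>i::int. f (nat \<bar>i\<bar>)) has_sum (suminf f - f 0)) (range (\<lambda>n. - int (Suc n)))"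
  proof -
    have "nat \<bar>- int (Suc n)\<bar> = Suc n" for n by simp
    then show ?thesis
      by (subst has_sum_reindex[OF i2]) (use 2 in \<open>simp only: o_def\<close>)
  qed
  moreover have "range int \<inter> range (\<lambda>n. - int (Suc n)) = {}" by auto
  ultimately have "((\<lambda>i::int. f (nat \<bar>i\<bar>)) has_sum (suminf f + (suminf f - f 0)))
      (range int \<union> range (\<lambda>n. - int (Suc n)))"
    by (rule has_sum_Un_disjoint)
  moreover have "range int \<union> range (\<lambda>n. - int (Suc n)) = UNIV"
  proof -
    have "i \<in> range int \<union> range (\<lambda>n. - int (Suc n))" for i by (cases i rule: int_cases) blast+
    then show ?thesis by blast
  qed
  ultimately show ?thesis by (simp only:)
qed

text \<open>Turns bounds on logarithms of ratios into bounds on the ratios. The factor 2 comes from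
  \<open>exp x \<le> 1 + x + x^2\<close> on the unit interval.\<close>

lemma abs_minus_one_le_ln:
  fixes r :: real
  assumes "0 < r" "\<bar>ln r\<bar> \<le> 1"
  shows "\<bar>r - 1\<bar> \<le> 2 * \<bar>ln r\<bar>"
proof (cases "1 \<le> r")
  case True
  then have l: "0 \<le> ln r" "ln r \<le> 1" using assms by auto
  then have "exp (ln r) \<le> 1 + ln r + (ln r)\<^sup>2" by (rule exp_bound)
  moreover have "(ln r)\<^sup>2 \<le> ln r"
    using l by (simp add: power2_eq_square mult_left_le)
  ultimately show ?thesis using l True assms by simp
next
  case False
  then have "ln r < 0" using assms by simp
  moreover have "1 + ln r \<le> exp (ln r)" by (rule exp_ge_add_one_self)
  ultimately show ?thesis using False assms by simp
qed

lemma exists_gap_lengths: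
  assumes \<alpha>: "concave_modulus \<alpha>"
    and diff: "\<And>t. t > 0 \<Longrightarrow> \<alpha> differentiable (at t)"
    and int: "(\<integral>\<^sup>+ t\<in>{0<..1}. ennreal (modulus_inv \<alpha> t / t\<^sup>2) \<partial>lborel) < \<infinity>"
    and bdd: "bdd_above ((\<lambda>t. \<alpha> t / (t * deriv \<alpha> t)) ` {0<..})"
  obtains l :: "int \<Rightarrow> real" and C :: real
  where "\<And>i. 0 < l i" "l summable_on UNIV" "infsum l UNIV < 1"
    "\<And>i. \<bar>l (i + 1) / l i - 1\<bar> \<le> 1 / 3"
    "\<And>i. \<bar>l (i + 1) / l i - 1\<bar> \<le> C * \<alpha> (l i)"
    "\<And>e. 0 < e \<Longrightarrow> finite {i. e \<le> \<bar>l (i + 1) / l i - 1\<bar>}"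
proof -
  obtain M0 where M0: "\<And>t. t > 0 \<Longrightarrow> \<alpha> t / (t * deriv \<alpha> t) \<le> M0"
    using bdd by (auto simp: bdd_above_def)
  define M where "M = max M0 1"
  have M: "\<And>t. t > 0 \<Longrightarrow> \<alpha> t / (t * deriv \<alpha> t) \<le> M" "1 \<le> M"
    using M0 by (force simp: M_def)+
  define b where "b n = modulus_inv \<alpha> (1 / (real n + 2))" for n :: nat
  have b0: "0 \<le> b n" for n by (simp add: b_def modulus_inv_right[OF \<alpha>])
  have sb: "summable b"
    using modulus_inv_reciprocals_summable[OF \<alpha> int] by (simp add: b_def[abs_def])
  \<comment> \<open>The tail is taken below 1/2 because each positive absolute value occurs twice in
    the sum over all integers, which must stay below 1.\<close>
  obtain N1 where N1: "\<And>n. n \<ge> N1 \<Longrightarrow> norm (\<Sum>i. b (i + n)) < 1 / 2"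
    using suminf_exist_split[OF _ sb, of "1 / 2"] by auto
  \<comment> \<open>With \<open>12 * M\<close> the logarithm of each ratio is at most 1/6 in size
    and the ratio is within 1/3 of 1. As the bumps have height 3/2, the derivative will then be at
    least 1/2.\<close>
  define N where "N = max N1 (nat \<lceil>12 * M\<rceil>)"
  have N: "12 * M \<le> real N" unfolding N_def by linarith
  define f where "f n = b (n + N)" for n
  define l where "l i = f (nat \<bar>i\<bar>)" for i :: int
  have f0: "0 \<le> f n" for n by (simp add: f_def b0)
  have sf: "summable f" using sb by (simp add: f_def[abs_def])
  have "norm (suminf f) < 1 / 2" unfolding f_def by (rule N1) (simp add: N_def)
  then have sf2: "suminf f < 1 / 2" by simp
  have hs: "(l has_sum (suminf f + (suminf f - f 0))) UNIV"
    unfolding l_def by (rule has_sum_int_abs[OF f0 sf])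
  define s where "s i = 1 / (real_of_int \<bar>i\<bar> + real N + 2)" for i :: int
  have s0: "0 < s i" for i by (simp add: s_def)
  have ls: "l i = modulus_inv \<alpha> (s i)" for i
    by (simp add: l_def f_def b_def s_def)
  have l0: "0 < l i" for i using modulus_inv_pos[OF \<alpha> s0] by (simp add: ls)
  \<comment> \<open>Here \<open>j\<close> is one step farther from 0 than \<open>i\<close>. Both
    \<open>s i\<close> and \<open>s j\<close> are needed as bounds: the ratio of index
    \<open>i\<close> compares \<open>i\<close> with \<open>i + 1\<close>, which is the farther index
    for \<open>i \<ge> 0\<close> and the nearer one otherwise.\<close>
  have step: "\<bar>ln (modulus_inv \<alpha> (s i)) - ln (modulus_inv \<alpha> (s j))\<bar> \<le> 2 * M * s i
      \<and> \<bar>ln (modulus_inv \<alpha> (s i)) - ln (modulus_inv \<alpha> (s j))\<bar> \<le> 2 * M * s j"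
    if ij: "\<bar>j\<bar> = \<bar>i\<bar> + 1" for i j
  proof -
    have sj: "s j \<le> s i" using ij by (simp add: s_def frac_le)
    have le: "ln (modulus_inv \<alpha> (s j)) \<le> ln (modulus_inv \<alpha> (s i))"
      using modulus_inv_mono[OF \<alpha> _ sj] modulus_inv_pos[OF \<alpha> s0] s0[of j] by simp
    have "ln (modulus_inv \<alpha> (s i)) - ln (modulus_inv \<alpha> (s j)) \<le> M * (ln (s i) - ln (s j))"
      by (rule ln_modulus_inv_le[OF \<alpha> diff M(1) s0 sj])
    also have "\<dots> \<le> M * ((s i - s j) / s j)"
      using M(2) ln_diff_le[OF s0 s0] by (intro mult_left_mono) auto
    \<comment> \<open>For reciprocals of consecutive numbers,
      \<open>(1 / x - 1 / (x + 1)) * (x + 1)\<close> is exactly \<open>1 / x\<close>.\<close>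
    also have "(s i - s j) / s j = s i"
    proof -
      define x where "x = real_of_int \<bar>i\<bar> + real N + 2"
      have x: "0 < x" and e: "s i = 1 / x" "s j = 1 / (x + 1)" using ij by (simp_all add: x_def s_def)
      have "x + x * x \<noteq> 0" using x by (simp add: add_pos_pos less_imp_neq[symmetric])
      then show ?thesis unfolding e using x by (simp add: field_simps)
    qed
    finally have *: "ln (modulus_inv \<alpha> (s i)) - ln (modulus_inv \<alpha> (s j)) \<le> M * s i" .
    have "s j = 1 / (real_of_int \<bar>i\<bar> + real N + 3)" using ij by (simp add: s_def)
    then have "s i \<le> 2 * s j" by (simp add: s_def field_simps)
    then have "M * s i \<le> M * (2 * s j)" using M(2) by (intro mult_left_mono) auto
    moreover have "0 \<le> M * s i" using M(2) s0[of i] by simp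
    ultimately show ?thesis using * le by (simp add: abs_if)
  qed
  have lnr: "\<bar>ln (l (i + 1) / l i)\<bar> \<le> 2 * M * s i" for i
  proof -
    have eq: "ln (l (i + 1) / l i) = ln (modulus_inv \<alpha> (s (i + 1))) - ln (modulus_inv \<alpha> (s i))"
      using l0[of i] l0[of "i + 1"] by (simp add: ln_div ls)
    show ?thesis
    proof (cases "0 \<le> i")
      case True
      with step[of "i + 1" i] show ?thesis by (simp add: eq abs_minus_commute)
    next
      case False
      with step[of i "i + 1"] show ?thesis by (simp add: eq abs_minus_commute)
    qed
  qed
  have sN: "2 * M * s i \<le> 1 / 6" for i
  proof -
    have "12 * M \<le> real_of_int \<bar>i\<bar> + real N + 2" using N by simp
    then show ?thesis by (simp add: s_def field_simps)
  qed
  have r: "\<bar>l (i + 1) / l i - 1\<bar> \<le> 4 * M * s i" for i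
  proof -
    have "\<bar>l (i + 1) / l i - 1\<bar> \<le> 2 * \<bar>ln (l (i + 1) / l i)\<bar>"
      using lnr[of i] sN[of i] l0 by (intro abs_minus_one_le_ln) auto
    with lnr[of i] show ?thesis by simp
  qed
  show thesis
  proof (rule that[of l "4 * M"])
    show "0 < l i" for i by (rule l0)
    show "l summable_on UNIV" using hs by (auto simp: summable_on_def)
    show "infsum l UNIV < 1" using infsumI[OF hs] sf2 f0[of 0] by simp
    show "\<bar>l (i + 1) / l i - 1\<bar> \<le> 1 / 3" for i using r[of i] sN[of i] by simp
    show "\<bar>l (i + 1) / l i - 1\<bar> \<le> 4 * M * \<alpha> (l i)" for i
      using r[of i] s0[of i] by (simp add: ls modulus_inv_right[OF \<alpha>])
    show "finite {i. e \<le> \<bar>l (i + 1) / l i - 1\<bar>}" if e: "0 < e" for e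
    proof (rule finite_subset)
      show "{i. e \<le> \<bar>l (i + 1) / l i - 1\<bar>} \<subseteq> {- \<lceil>4 * M / e\<rceil>..\<lceil>4 * M / e\<rceil>}"
      proof
        fix i assume "i \<in> {i. e \<le> \<bar>l (i + 1) / l i - 1\<bar>}"
        then have "e \<le> 4 * M * s i" using r[of i] by simp
        then have "real_of_int \<bar>i\<bar> + real N + 2 \<le> 4 * M / e"
          using e by (simp add: s_def field_simps)
        then have "real_of_int \<bar>i\<bar> \<le> 4 * M / e" by simp
        then have "\<bar>i\<bar> \<le> \<lceil>4 * M / e\<rceil>" by linarith
        then show "i \<in> {- \<lceil>4 * M / e\<rceil>..\<lceil>4 * M / e\<rceil>}" by auto
      qed
    qed simp
  qed
qed

subsection \<open>Bump functions\<close>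

lemma degree_one_add_int:
  fixes F :: "real \<Rightarrow> real"
  assumes "\<And>x. F (x + 1) = F x + 1"
  shows "F (x + of_int k) = F x + of_int k"
proof (induction k rule: int_induct[where k = 0])
  case (step1 i)
  then show ?case using assms[of "x + of_int i"] by (simp add: add.assoc)
next
  case (step2 i)
  then show ?case using assms[of "x + of_int (i - 1)"] by (simp add: algebra_simps)
qed simp

lemma periodic_add_int:
  fixes g :: "real \<Rightarrow> 'a"
  assumes "\<And>x. g (x + 1) = g x"
  shows "g (x + of_int k) = g x"
proof (induction k rule: int_induct[where k = 0])
  case (step1 i)
  then show ?case using assms[of "x + of_int i"] by (simp add: add.assoc)
next
  case (step2 i)
  then show ?case using assms[of "x + of_int (i - 1)"] by (simp add: algebra_simps)
qed simp

definition clamp01 :: "real \<Rightarrow> real" where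
  "clamp01 v = max 0 (min 1 v)"

text \<open>Normalised to integral 1, with antiderivative \<open>step\<close>: adding
  \<open>l (i + 1) / l i - 1\<close> times a copy rescaled to a gap of length \<open>l i\<close> to
  the derivative 1 gives the image of that gap the length \<open>l (i + 1)\<close>.\<close>

definition bump :: "real \<Rightarrow> real" where
  "bump v = 6 * clamp01 v * (1 - clamp01 v)"

definition step :: "real \<Rightarrow> real" where
  "step v = 3 * (clamp01 v)\<^sup>2 - 2 * clamp01 v ^ 3"

lemma bump_bounds: "0 \<le> bump v" "bump v \<le> 3 / 2"
proof -
  have c: "0 \<le> clamp01 v" "clamp01 v \<le> 1" by (auto simp: clamp01_def)
  then show "0 \<le> bump v" by (simp add: bump_def)
  have "0 \<le> 6 * (clamp01 v - 1 / 2)\<^sup>2" by simp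
  then show "bump v \<le> 3 / 2" by (simp add: bump_def power2_eq_square algebra_simps)
qed

lemma bump_eq_0: "v \<le> 0 \<or> 1 \<le> v \<Longrightarrow> bump v = 0"
  by (auto simp: bump_def clamp01_def)

lemma bump_lipschitz: "\<bar>bump v - bump w\<bar> \<le> 6 * \<bar>v - w\<bar>"
proof -
  have "bump v - bump w = 6 * ((clamp01 v - clamp01 w) * (1 - clamp01 v - clamp01 w))"
    by (simp add: bump_def algebra_simps)
  then have "\<bar>bump v - bump w\<bar> = 6 * (\<bar>clamp01 v - clamp01 w\<bar> * \<bar>1 - clamp01 v - clamp01 w\<bar>)"
    by (simp add: abs_mult)
  moreover have "\<bar>clamp01 v - clamp01 w\<bar> * \<bar>1 - clamp01 v - clamp01 w\<bar> \<le> \<bar>v - w\<bar> * 1"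
    by (intro mult_mono) (auto simp: clamp01_def)
  ultimately show ?thesis by simp
qed

lemma step_eq: "v \<le> 0 \<Longrightarrow> step v = 0" "1 \<le> v \<Longrightarrow> step v = 1"
  by (auto simp: step_def clamp01_def)

lemma step_bounds: "0 \<le> step v" "step v \<le> 1"
proof -
  have c: "0 \<le> clamp01 v" "clamp01 v \<le> 1" by (auto simp: clamp01_def)
  have "0 \<le> (clamp01 v)\<^sup>2 * (3 - 2 * clamp01 v)" using c by simp
  then show "0 \<le> step v" by (simp add: step_def power2_eq_square power3_eq_cube algebra_simps)
  have "0 \<le> (1 - clamp01 v)\<^sup>2 * (1 + 2 * clamp01 v)" using c by simp
  then show "step v \<le> 1" by (simp add: step_def power2_eq_square power3_eq_cube algebra_simps)
qed

text \<open>The cubic \<open>step\<close> can be written through squares of positive parts, so this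
  is the only corner to be treated by hand. At 0 the difference quotient is \<open>max 0\<close>
  itself, which is continuous.\<close>

lemma has_derivative_pos_part_square:
  "((\<lambda>v. (max 0 v)\<^sup>2) has_real_derivative 2 * max 0 v) (at v)" for v :: real
proof (cases v "0 :: real" rule: linorder_cases)
  case less
  have "((\<lambda>v. (max 0 v)\<^sup>2) has_real_derivative 0) (at v)"
    by (rule has_field_derivative_transform_within_open[of "\<lambda>_. 0" _ _ "{..<0}"]) (use less in auto)
  then show ?thesis using less by simp
next
  case equal
  have "\<exists>g. (\<forall>z. (max 0 z)\<^sup>2 - (max 0 (0::real))\<^sup>2 = g z * (z - 0)) \<and> isCont g 0 \<and> g 0 = 0"
    by (intro exI[of _ "max 0"]) (auto simp: power2_eq_square max_def intro!: continuous_intros)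
  then have "((\<lambda>v. (max 0 v)\<^sup>2) has_real_derivative 0) (at (0::real))"
    by (subst CARAT_DERIV)
  then show ?thesis using equal by simp
next
  case greater
  have "((\<lambda>v. (max 0 v)\<^sup>2) has_real_derivative 2 * v) (at v)"
    by (rule has_field_derivative_transform_within_open[of "\<lambda>v. v\<^sup>2" _ _ "{0<..}"])
      (use greater in \<open>auto intro!: derivative_eq_intros\<close>)
  then show ?thesis using greater by simp
qed

lemma has_derivative_step: "(step has_real_derivative bump v) (at v)"
proof -
  \<comment> \<open>The truncated power form of the spline: beyond 1, the terms in
    \<open>v - 1\<close> reduce \<open>3 * v^2 - 2 * v^3\<close> to the constant 1.\<close>
  have eq: "step = (\<lambda>v. 3 * (max 0 v)\<^sup>2 - 2 * ((max 0 v)\<^sup>2 * v)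
      + 3 * (max 0 (v - 1))\<^sup>2 + 2 * ((max 0 (v - 1))\<^sup>2 * (v - 1)))"
    by (rule ext) (auto simp: step_def clamp01_def max_def min_def power2_eq_square
        power3_eq_cube algebra_simps)
  have 1: "((\<lambda>v. (max 0 (v - 1))\<^sup>2) has_real_derivative 2 * max 0 (v - 1)) (at v)" for v :: real
  proof -
    have "((\<lambda>v. v - 1) has_real_derivative 1) (at v)" by (auto intro!: derivative_eq_intros)
    from DERIV_chain2[OF has_derivative_pos_part_square this] show ?thesis by simp
  qed
  show ?thesis
    unfolding eq
    by (rule derivative_eq_intros has_derivative_pos_part_square 1 refl)+
      (auto simp: bump_def clamp01_def max_def min_def power2_eq_square algebra_simps)
qed

text \<open>A smoothed floor function: it rises on the intervals \<open>[k, k + l]\<close> with \<open>k\<close> an integer and is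
  constant between them.\<close>

definition stair :: "real \<Rightarrow> real \<Rightarrow> real" where
  "stair l z = of_int \<lfloor>z\<rfloor> + step (frac z / l)"

text \<open>The formula for a fixed \<open>k\<close> reaches back into the flat stretch before
  \<open>k\<close>. So every point, an integer included, has a neighbourhood on which one formula
  holds, although the floor jumps at integers.\<close>

lemma stair_eq_on:
  assumes "0 < l" "of_int k - 1 + l < z" "z < of_int k + 1"
  shows "stair l z = of_int k + step ((z - of_int k) / l)"
proof (cases "of_int k \<le> z")
  case True
  then have "\<lfloor>z\<rfloor> = k" using assms by linarith
  then show ?thesis by (simp add: stair_def frac_def)
next
  case False
  have "0 \<le> z - (of_int k - 1)" using assms by simp
  then have fl: "\<lfloor>z\<rfloor> = k - 1" using False by linarith
  then have "l \<le> frac z" using assms by (simp add: frac_def)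
  then have "step (frac z / l) = 1" using assms by (intro step_eq) simp
  moreover have "step ((z - of_int k) / l) = 0"
    using False assms by (intro step_eq) (simp add: divide_le_0_iff)
  ultimately show ?thesis using fl by (simp add: stair_def)
qed

lemma has_derivative_stair:
  assumes "0 < l" "l < 1"
  shows "(stair l has_real_derivative bump (frac z / l) / l) (at z)"
proof -
  let ?k = "\<lfloor>z\<rfloor>"
  have z: "z \<in> {of_int ?k - 1 + l<..<of_int ?k + 1}" using assms by auto linarith+
  have "((\<lambda>z. of_int ?k + step ((z - of_int ?k) / l)) has_real_derivative
      bump ((z - of_int ?k) / l) * (1 / l)) (at z)"
  proof -
    have "((\<lambda>z. (z - of_int ?k) / l) has_real_derivative 1 / l) (at z)"
      using assms by (auto intro!: derivative_eq_intros)
    from DERIV_add[OF DERIV_const DERIV_chain2[OF has_derivative_step this]] show ?thesis by simp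
  qed
  then have "(stair l has_real_derivative bump ((z - of_int ?k) / l) * (1 / l)) (at z)"
    by (rule has_field_derivative_transform_within_open[OF _ _ z])
      (use assms stair_eq_on[of l ?k] in auto)
  then show ?thesis by (simp add: frac_def)
qed

lemma stair_add_1: "stair l (z + 1) = stair l z + 1"
  by (simp add: stair_def frac_def)

text \<open>Both ends of the flat stretch are included: at \<open>k + 1\<close> the floor has
  already jumped, but the next rise starts from 0.\<close>

lemma stair_eq:
  assumes "0 < l" "l < 1" "of_int k + l \<le> z" "z \<le> of_int k + 1"
  shows "stair l z = of_int k + 1"
proof (cases "z = of_int k + 1")
  case True
  then have "z = of_int (k + 1)" by simp
  then show ?thesis by (simp add: stair_def step_eq frac_def)
next
  case False
  then have "\<lfloor>z\<rfloor> = k" using assms by linarith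
  then show ?thesis using assms by (simp add: stair_def frac_def step_eq)
qed

lemma stair_near: "\<bar>stair l z - z\<bar> \<le> 1"
proof -
  have "stair l z - z = step (frac z / l) - frac z" by (simp add: stair_def frac_def)
  then show ?thesis
    using step_bounds[of "frac z / l"] frac_ge_0[of z] frac_lt_1[of z] by linarith
qed

lemma bump_frac_nonzero:
  assumes "0 < l" "bump (frac z / l) \<noteq> 0"
  shows "0 < frac z" "frac z < l"
proof -
  have "0 < frac z / l" "frac z / l < 1"
    using assms(2) bump_eq_0[of "frac z / l"] not_le by blast+
  then show "0 < frac z" "frac z < l" using assms(1) by (simp_all add: zero_less_divide_iff)
qed

text \<open>\<open>frac\<close> jumps at the integers, but the bump vanishes at 0 and from
  \<open>l\<close> on. If an integer separates \<open>y\<close> and \<open>z\<close>, each value is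
  compared with the zero at an end of its own unit interval, and the two distances add up to at most
  that between \<open>y\<close> and \<open>z\<close>.\<close>

lemma bump_frac_lipschitz:
  assumes l: "0 < l" "l < 1"
  shows "\<bar>bump (frac y / l) - bump (frac z / l)\<bar> \<le> 6 * (\<bar>y - z\<bar> / l)"
proof -
  have same: "\<bar>bump (u / l) - bump (v / l)\<bar> \<le> 6 * (\<bar>u - v\<bar> / l)" for u v
    using bump_lipschitz[of "u / l" "v / l"] l by (simp add: diff_divide_distrib[symmetric])
  have le: "\<bar>bump (frac y / l) - bump (frac z / l)\<bar> \<le> 6 * ((z - y) / l)" if yz: "y \<le> z" for y z
  proof (cases "\<lfloor>y\<rfloor> = \<lfloor>z\<rfloor>")
    case True
    then have "\<bar>frac y - frac z\<bar> = z - y" using yz by (simp add: frac_def)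
    with same[of "frac y" "frac z"] show ?thesis by simp
  next
    case False
    then have "\<lfloor>y\<rfloor> + 1 \<le> \<lfloor>z\<rfloor>" using floor_mono[OF yz] by simp
    then have "real_of_int \<lfloor>y\<rfloor> + 1 \<le> real_of_int \<lfloor>z\<rfloor>" by linarith
    then have "(1 - frac y) + frac z \<le> z - y" by (simp add: frac_def)
    then have sum: "6 * ((1 - frac y) / l) + 6 * (frac z / l) \<le> 6 * ((z - y) / l)"
      using l by (simp add: divide_simps)
    have "\<bar>bump (frac y / l)\<bar> \<le> 6 * ((1 - frac y) / l)"
      using same[of "frac y" 1] frac_lt_1[of y] l by (simp add: bump_eq_0)
    moreover have "\<bar>bump (frac z / l)\<bar> \<le> 6 * (frac z / l)"
      using same[of "frac z" 0] by (simp add: bump_eq_0)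
    ultimately show ?thesis using sum by linarith
  qed
  show ?thesis
    using le[of y z] le[of z y] by (cases "y \<le> z") (auto simp: abs_minus_commute)
qed

subsection \<open>Blowing up an orbit of the rotation\<close>

lemma infsum_diff:
  fixes f g :: "'a \<Rightarrow> real"
  assumes "f summable_on A" "g summable_on A"
  shows summable_on_diff: "(\<lambda>x. f x - g x) summable_on A"
    and "(\<Sum>\<^sub>\<infinity>x\<in>A. f x - g x) = (\<Sum>\<^sub>\<infinity>x\<in>A. f x) - (\<Sum>\<^sub>\<infinity>x\<in>A. g x)"
proof -
  have "((\<lambda>x. f x + - g x) has_sum (infsum f A + - infsum g A)) A"
    using assms by (intro has_sum_add has_sum_uminusI has_sum_infsum)
  then show "(\<lambda>x. f x - g x) summable_on A"
    "(\<Sum>\<^sub>\<infinity>x\<in>A. f x - g x) = (\<Sum>\<^sub>\<infinity>x\<in>A. f x) - (\<Sum>\<^sub>\<infinity>x\<in>A. g x)"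
    by (auto simp: summable_on_def dest: infsumI)
qed

text \<open>Passes from unconditional sums over the integers to limits of sequences, the form used
  for termwise differentiation.\<close>

lemma filterlim_symmetric_int_intervals:
  "filterlim (\<lambda>n. {- int n..int n}) (finite_subsets_at_top UNIV) sequentially"
  unfolding filterlim_finite_subsets_at_top
proof (intro allI impI)
  fix X :: "int set" assume X: "finite X \<and> X \<subseteq> UNIV"
  define N where "N = nat (Max (insert 0 (abs ` X)))"
  have "\<bar>i\<bar> \<le> int N" if "i \<in> X" for i
  proof -
    have "\<bar>i\<bar> \<le> Max (insert 0 (abs ` X))" using X that by (intro Max_ge) auto
    moreover have "0 \<le> Max (insert 0 (abs ` X))" using X by (intro Max_ge) auto
    ultimately show ?thesis by (simp add: N_def)
  qed
  then have "X \<subseteq> {- int n..int n}" if "N \<le> n" for n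
    using that by (force simp: abs_le_iff)
  then show "eventually (\<lambda>n. finite {- int n..int n} \<and> X \<subseteq> {- int n..int n} \<and>
      {- int n..int n} \<subseteq> UNIV) sequentially"
    unfolding eventually_sequentially by auto
qed

text \<open>Facts about the lengths alone; the modulus returns with the \<alpha>-continuity of the
  derivative. The bound 1/3 keeps the derivative positive, and \<open>l_ratio_finite\<close> says
  that the ratios tend to 1 in both directions.\<close>

locale gap_lengths =
  fixes \<theta> :: real and l :: "int \<Rightarrow> real"
  assumes irrational: "\<theta> \<notin> \<rat>"
    and l_pos: "0 < l i"
    and l_summable: "l summable_on UNIV"
    and l_total: "infsum l UNIV < 1"
    and l_ratio: "\<bar>l (i + 1) / l i - 1\<bar> \<le> 1 / 3"
    and l_ratio_finite: "0 < e \<Longrightarrow> finite {i. e \<le> \<bar>l (i + 1) / l i - 1\<bar>}"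
begin

text \<open>The length left outside the gaps. Apart from its jumps, the blow-up scales the rotation
  coordinate by this factor, which makes it strictly increasing.\<close>

definition slack :: real where
  "slack = 1 - infsum l UNIV"

lemma slack_pos: "0 < slack"
  using l_total by (simp add: slack_def)

definition wsum :: "(int \<Rightarrow> real) \<Rightarrow> real" where
  "wsum c = (\<Sum>\<^sub>\<infinity>i. l i * c i)"

lemma wsum_summable:
  assumes "\<And>i. \<bar>c i\<bar> \<le> B"
  shows "(\<lambda>i. l i * c i) summable_on UNIV"
proof (rule abs_summable_summable)
  have "(\<lambda>i. l i * B) summable_on UNIV" using l_summable by (rule summable_on_cmult_left)
  then show "(\<lambda>i. norm (l i * c i)) summable_on UNIV"
  proof (rule Infinite_Sum.abs_summable_on_comparison_test')
    show "norm (l i * c i) \<le> l i * B" for i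
      using assms[of i] l_pos[of i] by (simp add: abs_mult)
  qed
qed

lemma wsum_mono:
  assumes "\<And>i. \<bar>c i\<bar> \<le> B" "\<And>i. \<bar>d i\<bar> \<le> B'" "\<And>i. c i \<le> d i"
  shows "wsum c \<le> wsum d"
  unfolding wsum_def
  by (intro infsum_mono wsum_summable[of _ B] wsum_summable[of _ B'])
    (use assms l_pos in \<open>auto simp: less_imp_le intro!: mult_left_mono\<close>)

lemma wsum_add:
  assumes "\<And>i. \<bar>c i\<bar> \<le> B" "\<And>i. \<bar>d i\<bar> \<le> B'"
  shows "wsum (\<lambda>i. c i + d i) = wsum c + wsum d"
  unfolding wsum_def distrib_left
  using assms by (intro infsum_add wsum_summable)

lemma wsum_const: "wsum (\<lambda>_. k) = (1 - slack) * k"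
  unfolding wsum_def slack_def by (simp add: infsum_cmult_left')

lemma wsum_indicator: "wsum (\<lambda>j. if j = i then 1 else 0) = l i"
proof -
  have "wsum (\<lambda>j. if j = i then 1 else 0) = infsum l {i}"
    unfolding wsum_def by (intro infsum_cong_neutral) auto
  then show ?thesis by simp
qed

lemma wsum_abs_le:
  assumes "\<And>i. \<bar>c i\<bar> \<le> B"
  shows "\<bar>wsum c\<bar> \<le> (1 - slack) * B"
proof -
  have c: "c i \<le> B" "- B \<le> c i" for i using assms[of i] by linarith+
  have "wsum c \<le> wsum (\<lambda>_. B)" "wsum (\<lambda>_. - B) \<le> wsum c"
    by (rule wsum_mono[OF assms, of _ "\<bar>B\<bar>"] wsum_mono[OF _ assms, of _ "\<bar>B\<bar>"]; simp add: c)+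
  then show ?thesis by (simp add: wsum_const abs_le_iff)
qed

text \<open>Dominated convergence. Eventual equality replaces termwise limits because the counts are
  integers that become constant when a point is approached from one side.\<close>

lemma tendsto_wsum:
  assumes lim: "\<And>i. eventually (\<lambda>t. c t i = d i) G"
    and bound: "eventually (\<lambda>t. \<forall>i. \<bar>c t i\<bar> \<le> B) G"
  shows "((\<lambda>t. wsum (c t)) \<longlongrightarrow> wsum d) G"
proof (cases "G = bot")
  case False
  have d: "\<bar>d i\<bar> \<le> B" for i
  proof -
    have "eventually (\<lambda>t. \<bar>d i\<bar> \<le> B) G" using lim[of i] bound by eventually_elim metis
    then show ?thesis using False by simp
  qed
  have "((\<lambda>t. \<Sum>\<^sub>\<infinity>i. l i * c t i) \<longlongrightarrow> (\<Sum>\<^sub>\<infinity>i. l i * d i)) G"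
  proof (rule swap_uniform_limit')
    show "\<forall>\<^sub>F X in finite_subsets_at_top UNIV.
        ((\<lambda>t. \<Sum>i\<in>X. l i * c t i) \<longlongrightarrow> (\<Sum>i\<in>X. l i * d i)) G"
      by (intro always_eventually allI tendsto_sum tendsto_mult tendsto_const tendsto_eventually lim)
    show "((\<lambda>X. \<Sum>i\<in>X. l i * d i) \<longlongrightarrow> (\<Sum>\<^sub>\<infinity>i. l i * d i)) (finite_subsets_at_top UNIV)"
      using wsum_summable[OF d] by (simp add: has_sum_def[symmetric])
    show "uniform_limit {t. \<forall>i. \<bar>c t i\<bar> \<le> B} (\<lambda>X t. \<Sum>i\<in>X. l i * c t i)
        (\<lambda>t. \<Sum>\<^sub>\<infinity>i. l i * c t i) (finite_subsets_at_top UNIV)"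
      using l_summable
      by (intro Weierstrass_m_test_general[of _ _ _ "\<lambda>i. l i * B"] summable_on_cmult_left)
        (auto simp: abs_mult less_imp_le[OF l_pos] intro!: mult_mono)
    show "\<forall>\<^sub>F t in G. t \<in> {t. \<forall>i. \<bar>c t i\<bar> \<le> B}" using bound by simp
  qed simp
  then show ?thesis by (simp add: wsum_def)
qed simp

text \<open>On the line, the point \<open>i * \<theta> + k\<close> is blown up to an interval of length \<open>l i\<close>; \<open>phi_left\<close> and
  \<open>phi_right\<close> send a point to the two ends of what replaces it. Subtracting \<open>\<lceil>- (i * \<theta>)\<rceil>\<close> in the
  counts keeps them bounded in \<open>i\<close>, so that the weighted sums converge.\<close>

definition left_count :: "real \<Rightarrow> int \<Rightarrow> real" where
  "left_count x i = of_int (\<lceil>x - of_int i * \<theta>\<rceil> - 1 - \<lceil>- (of_int i * \<theta>)\<rceil>)"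

definition right_count :: "real \<Rightarrow> int \<Rightarrow> real" where
  "right_count x i = of_int (\<lfloor>x - of_int i * \<theta>\<rfloor> - \<lceil>- (of_int i * \<theta>)\<rceil>)"

definition phi_left :: "real \<Rightarrow> real" where
  "phi_left x = slack * x + wsum (left_count x)"

definition phi_right :: "real \<Rightarrow> real" where
  "phi_right x = slack * x + wsum (right_count x)"

lemma count_near: "\<bar>left_count x i - x\<bar> \<le> 2" "\<bar>right_count x i - x\<bar> \<le> 2"
  unfolding left_count_def right_count_def by linarith+

lemma count_bound: "\<bar>left_count x i\<bar> \<le> \<bar>x\<bar> + 2" "\<bar>right_count x i\<bar> \<le> \<bar>x\<bar> + 2"
  using count_near[of x i] by linarith+

lemma count_le: "left_count x i \<le> right_count x i"
  unfolding left_count_def right_count_def of_int_le_iff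
  using ceiling_diff_floor_le_1[of "x - of_int i * \<theta>"] by simp

lemma count_less: "x < y \<Longrightarrow> right_count x i \<le> left_count y i"
proof -
  assume "x < y"
  then have "of_int \<lfloor>x - of_int i * \<theta>\<rfloor> < y - of_int i * \<theta>"
    using of_int_floor_le[of "x - of_int i * \<theta>"] by linarith
  then have "\<lfloor>x - of_int i * \<theta>\<rfloor> < \<lceil>y - of_int i * \<theta>\<rceil>" by (simp add: less_ceiling_iff)
  then show ?thesis unfolding left_count_def right_count_def of_int_le_iff by simp
qed

lemma count_add_1: "left_count (x + 1) i = left_count x i + 1"
  "right_count (x + 1) i = right_count x i + 1"
proof -
  have "x + 1 - of_int i * \<theta> = (x - of_int i * \<theta>) + 1" by simp
  then have "\<lceil>x + 1 - of_int i * \<theta>\<rceil> = \<lceil>x - of_int i * \<theta>\<rceil> + 1"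
    "\<lfloor>x + 1 - of_int i * \<theta>\<rfloor> = \<lfloor>x - of_int i * \<theta>\<rfloor> + 1"
    by (simp_all only: ceiling_add_one one_add_floor)
  then show "left_count (x + 1) i = left_count x i + 1"
    "right_count (x + 1) i = right_count x i + 1"
    unfolding left_count_def right_count_def by simp_all
qed

lemma rotation_eq_iff:
  "of_int i * \<theta> + of_int k = of_int j * \<theta> + of_int m \<longleftrightarrow> i = j \<and> k = m"
proof
  assume eq: "of_int i * \<theta> + of_int k = of_int j * \<theta> + of_int m"
  then have *: "of_int (i - j) * \<theta> = of_int (m - k)" by (simp add: algebra_simps)
  have "i = j"
  proof (rule ccontr)
    assume "i \<noteq> j"
    then have "\<theta> = of_int (m - k) / of_int (i - j)" using * by (simp add: field_simps)
    then have "\<theta> \<in> \<rat>" by (metis Rats_divide Rats_of_int)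
    with irrational show False ..
  qed
  with eq show "i = j \<and> k = m" by simp
qed auto

lemma right_count_eq:
  assumes "\<And>k. x \<noteq> of_int i * \<theta> + of_int k"
  shows "right_count x i = left_count x i"
proof -
  have "x - of_int i * \<theta> \<notin> \<int>"
    using assms by (auto elim!: Ints_cases simp: diff_eq_eq add.commute)
  then have "\<lceil>x - of_int i * \<theta>\<rceil> = \<lfloor>x - of_int i * \<theta>\<rfloor> + 1"
    by (metis Ints_of_int ceiling_altdef)
  then show ?thesis by (simp add: left_count_def right_count_def)
qed

lemma right_count_rotation:
  "right_count (of_int i * \<theta> + of_int k) j
    = left_count (of_int i * \<theta> + of_int k) j + (if j = i then 1 else 0)"
proof (cases "j = i")
  case True
  then show ?thesis by (simp add: left_count_def right_count_def)
next
  case False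
  then show ?thesis using rotation_eq_iff by (subst right_count_eq) auto
qed

lemma phi_left_le_right: "phi_left x \<le> phi_right x"
  unfolding phi_left_def phi_right_def
  using wsum_mono[OF count_bound(1) count_bound(2) count_le] by simp

lemma phi_less:
  assumes "x < y"
  shows "phi_right x < phi_left y"
proof -
  have "wsum (right_count x) \<le> wsum (left_count y)"
    using count_less[OF assms] by (rule wsum_mono[OF count_bound(2) count_bound(1)])
  moreover have "slack * x < slack * y" using assms slack_pos by simp
  ultimately show ?thesis by (simp add: phi_left_def phi_right_def)
qed

lemma phi_add_1: "phi_left (x + 1) = phi_left x + 1" "phi_right (x + 1) = phi_right x + 1"
proof -
  have "wsum (\<lambda>i. left_count x i + 1) = wsum (left_count x) + (1 - slack) * 1"
    using wsum_add[OF count_bound(1), of "\<lambda>_. 1" 1] by (simp add: wsum_const)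
  moreover have "wsum (\<lambda>i. right_count x i + 1) = wsum (right_count x) + (1 - slack) * 1"
    using wsum_add[OF count_bound(2), of "\<lambda>_. 1" 1] by (simp add: wsum_const)
  ultimately show "phi_left (x + 1) = phi_left x + 1" "phi_right (x + 1) = phi_right x + 1"
    unfolding phi_left_def phi_right_def count_add_1[abs_def] by (simp_all add: algebra_simps)
qed

text \<open>As the weights sum to \<open>1 - slack\<close>, the difference
  \<open>slack * x + wsum c - x\<close> is the weighted sum of the numbers \<open>c i - x\<close>,
  each at most 2 in absolute value.\<close>

lemma phi_near: "\<bar>phi_left x - x\<bar> \<le> 2" "\<bar>phi_right x - x\<bar> \<le> 2"
proof -
  have *: "\<bar>slack * x + wsum c - x\<bar> \<le> 2" if c: "\<And>i. \<bar>c i\<bar> \<le> \<bar>x\<bar> + 2" "\<And>i. \<bar>c i - x\<bar> \<le> 2" for c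
  proof -
    have "wsum (\<lambda>i. c i + (- x)) = wsum c + (1 - slack) * (- x)"
      using wsum_add[OF c(1), of "\<lambda>_. - x" "\<bar>x\<bar>"] by (simp add: wsum_const)
    then have "slack * x + wsum c - x = wsum (\<lambda>i. c i - x)" by (simp add: algebra_simps)
    moreover have "\<bar>wsum (\<lambda>i. c i - x)\<bar> \<le> (1 - slack) * 2" by (rule wsum_abs_le[OF c(2)])
    ultimately show ?thesis using slack_pos by simp
  qed
  show "\<bar>phi_left x - x\<bar> \<le> 2" "\<bar>phi_right x - x\<bar> \<le> 2"
    unfolding phi_left_def phi_right_def by (rule *; rule count_bound count_near)+
qed

lemma phi_gap: "phi_right (of_int i * \<theta> + of_int k) = phi_left (of_int i * \<theta> + of_int k) + l i"
proof -
  let ?x = "of_int i * \<theta> + of_int k"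
  have "wsum (\<lambda>j. left_count ?x j + (if j = i then 1 else 0)) = wsum (left_count ?x) + l i"
    using wsum_add[OF count_bound(1), of "\<lambda>j. if j = i then 1 else 0" 1] by (simp add: wsum_indicator)
  then show ?thesis
    by (simp add: phi_left_def phi_right_def right_count_rotation[abs_def])
qed

lemma phi_no_gap:
  assumes "\<And>i k. x \<noteq> of_int i * \<theta> + of_int k"
  shows "phi_right x = phi_left x"
proof -
  have "right_count x = left_count x" using assms by (intro ext right_count_eq)
  then show ?thesis by (simp add: phi_left_def phi_right_def)
qed

lemma phi_add_int: "phi_left (x + of_int k) = phi_left x + of_int k"
  "phi_right (x + of_int k) = phi_right x + of_int k"
  using degree_one_add_int[of phi_left, OF phi_add_1(1)]
    degree_one_add_int[of phi_right, OF phi_add_1(2)] by blast+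

lemma eventually_at_left_bounded: "eventually (\<lambda>t::real. \<bar>t\<bar> \<le> \<bar>x\<bar> + 1) (at_left x)"
  using eventually_at_left_real[of "x - 1" x] by (auto elim!: eventually_mono)

lemma eventually_at_right_bounded: "eventually (\<lambda>t::real. \<bar>t\<bar> \<le> \<bar>x\<bar> + 1) (at_right x)"
  using eventually_at_right_real[of x "x + 1"] by (auto elim!: eventually_mono)

text \<open>For each \<open>i\<close>, once \<open>t\<close> is close below \<open>x\<close> there
  is no translate of \<open>i * \<theta>\<close> strictly between them, so the right count at
  \<open>t\<close> is the left count at \<open>x\<close>. Thus every left end is a limit of right
  ends from below.\<close>

lemma tendsto_phi_left: "(phi_right \<longlongrightarrow> phi_left x) (at_left x)"
  unfolding phi_right_def phi_left_def
proof (intro tendsto_add tendsto_mult tendsto_const tendsto_ident_at tendsto_wsum[where B = "\<bar>x\<bar> + 3"])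
  fix i
  \<comment> \<open>The last integer translate of \<open>i * \<theta>\<close> strictly before
    \<open>x\<close>.\<close>
  define m where "m = of_int \<lceil>x - of_int i * \<theta>\<rceil> - 1 + of_int i * \<theta>"
  have "m < x" unfolding m_def by linarith
  then have "eventually (\<lambda>t. t \<in> {m<..<x}) (at_left x)" by (rule eventually_at_left_real)
  then show "eventually (\<lambda>t. right_count t i = left_count x i) (at_left x)"
  proof eventually_elim
    case (elim t)
    then have "\<lfloor>t - of_int i * \<theta>\<rfloor> = \<lceil>x - of_int i * \<theta>\<rceil> - 1"
      unfolding m_def by (intro floor_unique) (auto; linarith)+
    then show ?case by (simp add: left_count_def right_count_def)
  qed
next
  show "eventually (\<lambda>t. \<forall>i. \<bar>right_count t i\<bar> \<le> \<bar>x\<bar> + 3) (at_left x)"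
    using eventually_at_left_bounded
  proof eventually_elim
    case (elim t)
    show ?case
    proof
      fix i
      show "\<bar>right_count t i\<bar> \<le> \<bar>x\<bar> + 3" using count_bound(2)[of t i] elim by linarith
    qed
  qed
qed

lemma tendsto_phi_right: "(phi_left \<longlongrightarrow> phi_right x) (at_right x)"
  unfolding phi_right_def phi_left_def
proof (intro tendsto_add tendsto_mult tendsto_const tendsto_ident_at tendsto_wsum[where B = "\<bar>x\<bar> + 3"])
  fix i
  define m where "m = of_int \<lfloor>x - of_int i * \<theta>\<rfloor> + 1 + of_int i * \<theta>"
  have "x < m" unfolding m_def by linarith
  then have "eventually (\<lambda>t. t \<in> {x<..<m}) (at_right x)" by (rule eventually_at_right_real)
  then show "eventually (\<lambda>t. left_count t i = right_count x i) (at_right x)"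
  proof eventually_elim
    case (elim t)
    then have "\<lceil>t - of_int i * \<theta>\<rceil> = \<lfloor>x - of_int i * \<theta>\<rfloor> + 1"
      unfolding m_def by (intro ceiling_unique) (auto; linarith)+
    then show ?case by (simp add: left_count_def right_count_def)
  qed
next
  show "eventually (\<lambda>t. \<forall>i. \<bar>left_count t i\<bar> \<le> \<bar>x\<bar> + 3) (at_right x)"
    using eventually_at_right_bounded
  proof eventually_elim
    case (elim t)
    show ?case
    proof
      fix i
      show "\<bar>left_count t i\<bar> \<le> \<bar>x\<bar> + 3" using count_bound(1)[of t i] elim by linarith
    qed
  qed
qed

section \<open>The collapsing map, inverse to both blow-up maps\<close>

definition collapse :: "real \<Rightarrow> real" where
  "collapse y = Sup {x. phi_left x \<le> y}"

lemma phi_left_mono: "x \<le> y \<Longrightarrow> phi_left x \<le> phi_left y"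
  using phi_less[of x y] phi_left_le_right[of x] by (cases "x = y") auto

lemma phi_right_mono: "x \<le> y \<Longrightarrow> phi_right x \<le> phi_right y"
  using phi_less[of x y] phi_left_le_right[of y] by (cases "x = y") auto

text \<open>At the supremum, the one-sided limits of \<open>phi_right\<close> from below and of
  \<open>phi_left\<close> from above exclude the opposite strict inequalities. Hence the closed
  intervals from \<open>phi_left x\<close> to \<open>phi_right x\<close> cover the line.\<close>

lemma collapse_between: "phi_left (collapse y) \<le> y" "y \<le> phi_right (collapse y)"
proof -
  let ?A = "{x. phi_left x \<le> y}" and ?h = "collapse y"
  have ne: "?A \<noteq> {}"
    using phi_near(1)[of "y - 2"] by (auto intro!: exI[of _ "y - 2"])
  have bdd: "bdd_above ?A"
  proof (rule bdd_aboveI)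
    fix x assume "x \<in> ?A"
    then show "x \<le> y + 2" using phi_near(1)[of x] by auto
  qed
  show "phi_left ?h \<le> y"
  proof (rule ccontr)
    assume "\<not> phi_left ?h \<le> y"
    then have "eventually (\<lambda>t. y < phi_right t) (at_left ?h)"
      using order_tendstoD(1)[OF tendsto_phi_left] by simp
    then obtain b where b: "b < ?h" "\<And>t. b < t \<Longrightarrow> t < ?h \<Longrightarrow> y < phi_right t"
      by (auto simp: eventually_at_left[of "?h - 1"])
    then have t: "y < phi_right ((b + ?h) / 2)" "(b + ?h) / 2 < ?h" by auto
    then obtain a where a: "a \<in> ?A" "(b + ?h) / 2 < a"
      using less_cSupE[OF _ ne] unfolding collapse_def by metis
    then show False using phi_less[OF a(2)] t by simp
  qed
  show "y \<le> phi_right ?h"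
  proof (rule ccontr)
    assume "\<not> y \<le> phi_right ?h"
    then have "eventually (\<lambda>t. phi_left t < y) (at_right ?h)"
      using order_tendstoD(2)[OF tendsto_phi_right] by simp
    then obtain b where b: "?h < b" "\<And>t. ?h < t \<Longrightarrow> t < b \<Longrightarrow> phi_left t < y"
      by (auto simp: eventually_at_right[of _ "?h + 1"])
    then have "(b + ?h) / 2 \<in> ?A" "?h < (b + ?h) / 2" by (auto simp: less_imp_le)
    then show False using cSup_upper[OF _ bdd] unfolding collapse_def by fastforce
  qed
qed

lemma collapse_unique:
  assumes "phi_left x \<le> y" "y \<le> phi_right x"
  shows "collapse y = x"
  using collapse_between[of y] assms phi_less[of x "collapse y"] phi_less[of "collapse y" x]
  by (cases x "collapse y" rule: linorder_cases) auto

lemma collapse_near: "\<bar>collapse y - y\<bar> \<le> 2"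
  using phi_near[of "collapse y"] collapse_between[of y] by linarith

subsection \<open>The lift of the diffeomorphism\<close>

definition gap_start :: "int \<Rightarrow> real" where
  "gap_start i = phi_left (of_int i * \<theta>)"

lemma phi_left_gap: "phi_left (of_int i * \<theta> + of_int k) = gap_start i + of_int k"
  by (simp add: gap_start_def phi_add_int)

lemma phi_right_gap: "phi_right (of_int i * \<theta> + of_int k) = gap_start i + of_int k + l i"
  by (simp add: phi_gap phi_left_gap)

lemma l_less_1: "l i < 1"
proof -
  have "infsum l {i} \<le> infsum l UNIV"
    using l_summable l_pos by (intro infsum_mono_neutral) (auto simp: less_imp_le)
  then show ?thesis using l_total by simp
qed

text \<open>No end of a blown-up point lies inside a gap, so it falls into a flat stretch of every
  staircase. There the smooth staircase reproduces the jumping count exactly.\<close>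

lemma stair_phi_left:
  "stair (l i) (phi_left x - gap_start i) = of_int \<lceil>x - of_int i * \<theta>\<rceil>"
proof -
  define k where "k = \<lceil>x - of_int i * \<theta>\<rceil> - 1"
  have "of_int i * \<theta> + of_int k < x" "x \<le> of_int i * \<theta> + of_int (k + 1)"
    unfolding k_def by linarith+
  then have "gap_start i + of_int k + l i \<le> phi_left x" "phi_left x \<le> gap_start i + of_int (k + 1)"
    using phi_less phi_left_mono phi_right_gap phi_left_gap by (metis less_imp_le)+
  then have "stair (l i) (phi_left x - gap_start i) = of_int k + 1"
    by (intro stair_eq l_pos l_less_1) auto
  then show ?thesis by (simp add: k_def)
qed

lemma stair_phi_right:
  "stair (l i) (phi_right x - gap_start i) = of_int \<lfloor>x - of_int i * \<theta>\<rfloor> + 1"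
proof -
  define k where "k = \<lfloor>x - of_int i * \<theta>\<rfloor>"
  have "of_int i * \<theta> + of_int k \<le> x" "x < of_int i * \<theta> + of_int (k + 1)"
    unfolding k_def by linarith+
  then have "gap_start i + of_int k + l i \<le> phi_right x" "phi_right x \<le> gap_start i + of_int (k + 1)"
    using phi_less phi_right_mono phi_right_gap phi_left_gap by (metis less_imp_le)+
  then have "stair (l i) (phi_right x - gap_start i) = of_int k + 1"
    by (intro stair_eq l_pos l_less_1) auto
  then show ?thesis by (simp add: k_def)
qed

text \<open>A continuous interpolation of \<open>left_count\<close> and \<open>right_count\<close>, as a function of the
  blown-up coordinate.\<close>

definition level :: "real \<Rightarrow> int \<Rightarrow> real" where
  "level y i = stair (l i) (y - gap_start i) - 1"

definition offset :: "int \<Rightarrow> real" where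
  "offset i = of_int \<lceil>- (of_int i * \<theta>)\<rceil>"

text \<open>The second identity carries the dynamics:
  \<open>x + \<theta> - (i + 1) * \<theta>\<close> is \<open>x - i * \<theta>\<close>, so rotating
  the point only shifts the index of the count.\<close>

lemma level_phi_left: "level (phi_left x) i - offset i = left_count x i"
  "level (phi_left x) i - offset (i + 1) = left_count (x + \<theta>) (i + 1)"
  by (simp_all add: level_def offset_def left_count_def stair_phi_left algebra_simps)

lemma level_phi_right: "level (phi_right x) i - offset i = right_count x i"
  "level (phi_right x) i - offset (i + 1) = right_count (x + \<theta>) (i + 1)"
  by (simp_all add: level_def offset_def right_count_def stair_phi_right algebra_simps)

lemma level_offset_bound: "\<bar>level y i - offset i\<bar> \<le> \<bar>y\<bar> + 5"
  "\<bar>level y i - offset (i + 1)\<bar> \<le> \<bar>y\<bar> + \<bar>\<theta>\<bar> + 6"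
proof -
  have "\<bar>gap_start i - of_int i * \<theta>\<bar> \<le> 2" using phi_near by (simp add: gap_start_def)
  moreover have "\<bar>level y i - (y - gap_start i - 1)\<bar> \<le> 1"
    using stair_near[of "l i" "y - gap_start i"] by (simp add: level_def)
  moreover have "\<bar>offset i + of_int i * \<theta>\<bar> \<le> 1" unfolding offset_def by linarith
  moreover have "\<bar>offset (i + 1) + of_int (i + 1) * \<theta>\<bar> \<le> 1" unfolding offset_def by linarith
  moreover have "of_int (i + 1) * \<theta> = of_int i * \<theta> + \<theta>" by (simp add: algebra_simps)
  ultimately show "\<bar>level y i - offset i\<bar> \<le> \<bar>y\<bar> + 5"
    "\<bar>level y i - offset (i + 1)\<bar> \<le> \<bar>y\<bar> + \<bar>\<theta>\<bar> + 6" by linarith+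
qed

lemma shift_bij: "bij_betw (\<lambda>i::int. i + 1) UNIV UNIV"
  by (rule bij_betw_byWitness[of _ "\<lambda>i. i - 1"]) auto

text \<open>The change of weight of staircase \<open>i\<close> when gap \<open>i\<close> is sent to
  gap \<open>i + 1\<close>. The two offsets differ so that each term matches the centred count of
  its own index.\<close>

definition disp :: "real \<Rightarrow> int \<Rightarrow> real" where
  "disp y i = l (i + 1) * (level y i - offset (i + 1)) - l i * (level y i - offset i)"

definition lift :: "real \<Rightarrow> real" where
  "lift y = y + slack * \<theta> + (\<Sum>\<^sub>\<infinity>i. disp y i)"

lemma shifted_summable:
  assumes "\<And>i. \<bar>c i\<bar> \<le> B"
  shows "(\<lambda>i. l (i + 1) * c i) summable_on UNIV"
proof -
  have "(\<lambda>i. l i * c (i - 1)) summable_on UNIV" using assms by (rule wsum_summable)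
  then show ?thesis
    using summable_on_reindex_bij_betw[OF shift_bij, of "\<lambda>i. l i * c (i - 1)"] by simp
qed

lemma disp_summable: "disp y summable_on UNIV"
  unfolding disp_def[abs_def]
  by (intro summable_on_diff shifted_summable[OF level_offset_bound(2)]
      wsum_summable[OF level_offset_bound(1)])

lemma infsum_disp:
  "(\<Sum>\<^sub>\<infinity>i. disp y i)
    = (\<Sum>\<^sub>\<infinity>i. l (i + 1) * (level y i - offset (i + 1))) - wsum (\<lambda>i. level y i - offset i)"
  unfolding disp_def wsum_def
  by (intro infsum_diff(2) shifted_summable[OF level_offset_bound(2)]
      wsum_summable[OF level_offset_bound(1)])

text \<open>At ends of blown-up points, the subtracted sum in \<open>infsum_disp\<close> cancels the
  weighted counts at \<open>x\<close>, and the other sum, after a shift of the index, is that of the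
  counts at \<open>x + \<theta>\<close>.\<close>

lemma lift_phi: "lift (phi_left x) = phi_left (x + \<theta>)" "lift (phi_right x) = phi_right (x + \<theta>)"
proof -
  have sh: "(\<Sum>\<^sub>\<infinity>i. l (i + 1) * c (i + 1)) = wsum c" for c
    unfolding wsum_def by (rule infsum_reindex_bij_betw[OF shift_bij])
  show "lift (phi_left x) = phi_left (x + \<theta>)" "lift (phi_right x) = phi_right (x + \<theta>)"
    unfolding lift_def infsum_disp level_phi_left level_phi_right sh
    by (simp_all add: phi_left_def phi_right_def distrib_left)
qed

lemma level_add_1: "level (y + 1) i = level y i + 1"
  using stair_add_1[of "l i" "y - gap_start i"] by (simp add: level_def algebra_simps)

text \<open>All levels rise by 1 over a period, so the displacement changes by the sum of
  \<open>l (i + 1) - l i\<close>, which vanishes by reindexing.\<close>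

lemma lift_add_1: "lift (y + 1) = lift y + 1"
proof -
  have s: "(\<lambda>i. l (i + 1)) summable_on UNIV"
    using summable_on_reindex_bij_betw[OF shift_bij, of l] l_summable by simp
  have "(\<Sum>\<^sub>\<infinity>i. disp (y + 1) i) = (\<Sum>\<^sub>\<infinity>i. disp y i + (l (i + 1) - l i))"
    unfolding disp_def level_add_1 by (rule infsum_cong) (simp add: algebra_simps)
  also have "\<dots> = (\<Sum>\<^sub>\<infinity>i. disp y i) + (\<Sum>\<^sub>\<infinity>i. l (i + 1) - l i)"
    using disp_summable s l_summable by (intro infsum_add summable_on_diff)
  also have "(\<Sum>\<^sub>\<infinity>i. l (i + 1) - l i) = (\<Sum>\<^sub>\<infinity>i. l (i + 1)) - (\<Sum>\<^sub>\<infinity>i. l i)"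
    using s l_summable by (rule infsum_diff(2))
  also have "(\<Sum>\<^sub>\<infinity>i. l (i + 1)) = (\<Sum>\<^sub>\<infinity>i. l i)"
    by (rule infsum_reindex_bij_betw[OF shift_bij])
  finally show ?thesis by (simp add: lift_def)
qed

section \<open>The derivative of the lift\<close>

definition slope_term :: "int \<Rightarrow> real \<Rightarrow> real" where
  "slope_term i y = (l (i + 1) / l i - 1) * bump (frac (y - gap_start i) / l i)"

lemma slope_term_le: "\<bar>slope_term i y\<bar> \<le> \<bar>l (i + 1) / l i - 1\<bar> * (3 / 2)"
proof -
  have "\<bar>bump v\<bar> \<le> 3 / 2" for v using bump_bounds[of v] by simp
  then show ?thesis unfolding slope_term_def abs_mult by (intro mult_left_mono) auto
qed

lemma slope_term_lipschitz:
  "\<bar>slope_term i y - slope_term i z\<bar> \<le> \<bar>l (i + 1) / l i - 1\<bar> * (6 * (\<bar>y - z\<bar> / l i))"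
proof -
  have "slope_term i y - slope_term i z = (l (i + 1) / l i - 1) *
      (bump (frac (y - gap_start i) / l i) - bump (frac (z - gap_start i) / l i))"
    by (simp add: slope_term_def right_diff_distrib)
  moreover have "\<bar>bump (frac (y - gap_start i) / l i) - bump (frac (z - gap_start i) / l i)\<bar>
      \<le> 6 * (\<bar>y - z\<bar> / l i)"
    using bump_frac_lipschitz[OF l_pos l_less_1, of "y - gap_start i" i "z - gap_start i"] by simp
  ultimately show ?thesis by (simp only: abs_mult mult_left_mono abs_ge_zero)
qed

lemma slope_term_add_1: "slope_term i (y + 1) = slope_term i y"
proof -
  have "frac (y + 1 - gap_start i) = frac (y - gap_start i)"
    using frac_1_eq[of "y - gap_start i"] by (simp add: algebra_simps)
  then show ?thesis by (simp add: slope_term_def)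
qed

text \<open>The bump lives inside the gaps of index \<open>i\<close>, and these collapse to
  translates of \<open>i * \<theta>\<close>. Since such points determine \<open>i\<close>, at most
  one term is nonzero at a given \<open>y\<close>.\<close>

lemma slope_term_nonzero:
  assumes "slope_term i y \<noteq> 0"
  obtains k where "collapse y = of_int i * \<theta> + of_int k"
proof -
  let ?k = "\<lfloor>y - gap_start i\<rfloor>"
  have "0 < frac (y - gap_start i)" "frac (y - gap_start i) < l i"
    using bump_frac_nonzero[OF l_pos] assms by (auto simp: slope_term_def)
  then have "phi_left (of_int i * \<theta> + of_int ?k) \<le> y" "y \<le> phi_right (of_int i * \<theta> + of_int ?k)"
    by (simp_all add: phi_left_gap phi_right_gap frac_def)
  then show thesis using that collapse_unique by blast
qed

lemma slope_term_unique:
  assumes "slope_term i y \<noteq> 0" "slope_term j y \<noteq> 0"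
  shows "i = j"
  using assms slope_term_nonzero rotation_eq_iff by metis

definition slope :: "real \<Rightarrow> real" where
  "slope y = 1 + (\<Sum>\<^sub>\<infinity>i. slope_term i y)"

lemma slope_eq: "slope_term i y \<noteq> 0 \<Longrightarrow> slope y = 1 + slope_term i y"
proof -
  assume "slope_term i y \<noteq> 0"
  then have "(\<Sum>\<^sub>\<infinity>j. slope_term j y) = (\<Sum>\<^sub>\<infinity>j\<in>{i}. slope_term j y)"
    using slope_term_unique by (intro infsum_cong_neutral) auto
  then show ?thesis by (simp add: slope_def)
qed

lemma slope_eq_1: "(\<And>i. slope_term i y = 0) \<Longrightarrow> slope y = 1"
  by (simp add: slope_def)

lemma slope_ge: "1 / 2 \<le> slope y"
proof (cases "\<exists>i. slope_term i y \<noteq> 0")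
  case True
  then obtain i where i: "slope_term i y \<noteq> 0" by blast
  have "\<bar>slope_term i y\<bar> \<le> 1 / 3 * (3 / 2)"
    using slope_term_le[of i y] mult_right_mono[OF l_ratio[of i], of "3 / 2"] by (rule order_trans) simp
  with slope_eq[OF i] show ?thesis by linarith
qed (simp add: slope_eq_1)

lemma slope_add_1: "slope (y + 1) = slope y"
  by (simp add: slope_def slope_term_add_1)

text \<open>At each \<open>y\<close> the omitted tail consists of at most one term, and its index is
  none of the finitely many with a ratio far from 1.\<close>

lemma slope_partial_sums:
  assumes "0 < e"
  shows "eventually (\<lambda>n. \<forall>y. \<bar>1 + (\<Sum>i\<in>{- int n..int n}. slope_term i y) - slope y\<bar> \<le> e) sequentially"
proof -
  \<comment> \<open>The threshold \<open>e / 2\<close> leaves room for the height 3/2 of the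
    bump.\<close>
  let ?X = "{i. e / 2 \<le> \<bar>l (i + 1) / l i - 1\<bar>}"
  have "finite ?X" by (rule l_ratio_finite) (use assms in simp)
  then have "eventually (\<lambda>n. ?X \<subseteq> {- int n..int n}) sequentially"
    using filterlim_symmetric_int_intervals
    unfolding filterlim_finite_subsets_at_top by (auto elim: eventually_mono)
  then show ?thesis
  proof eventually_elim
    case (elim n)
    have "\<bar>1 + (\<Sum>i\<in>{- int n..int n}. slope_term i y) - slope y\<bar> \<le> e" for y
    proof (cases "\<exists>i. slope_term i y \<noteq> 0")
      case True
      then obtain i where i: "slope_term i y \<noteq> 0" by blast
      have eq: "slope_term j y = (if j = i then slope_term i y else 0)" for j
        using slope_term_unique[OF i] by auto
      have sum: "(\<Sum>j\<in>{- int n..int n}. slope_term j y)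
          = (if i \<in> {- int n..int n} then slope_term i y else 0)"
        by (subst eq) (simp add: sum.delta)
      show ?thesis
      proof (cases "i \<in> {- int n..int n}")
        case True
        then show ?thesis using assms by (simp add: slope_eq[OF i] sum)
      next
        case False
        then have "\<bar>l (i + 1) / l i - 1\<bar> < e / 2" using elim by force
        then have "\<bar>l (i + 1) / l i - 1\<bar> * (3 / 2) \<le> e / 2 * (3 / 2)" by (intro mult_right_mono) auto
        with slope_term_le[of i y] have "\<bar>slope_term i y\<bar> \<le> e / 2 * (3 / 2)" by (rule order_trans)
        then have "\<bar>slope_term i y\<bar> \<le> e" using assms by simp
        then show ?thesis using False assms by (simp add: slope_eq[OF i] sum)
      qed
    next
      case False
      then show ?thesis using assms by (simp add: slope_eq_1)
    qed
    then show ?case ..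
  qed
qed

lemma slope_continuous: "continuous_on UNIV slope"
proof (rule uniform_limit_theorem)
  have "continuous_on UNIV (slope_term i)" for i
  proof (rule lipschitz_on_continuous_on)
    show "(\<bar>l (i + 1) / l i - 1\<bar> * 6 / l i)-lipschitz_on UNIV (slope_term i)"
    proof (rule lipschitz_onI)
      show "dist (slope_term i y) (slope_term i z) \<le> \<bar>l (i + 1) / l i - 1\<bar> * 6 / l i * dist y z" for y z
        using slope_term_lipschitz[of i y z] by (simp add: dist_real_def)
      show "0 \<le> \<bar>l (i + 1) / l i - 1\<bar> * 6 / l i" using l_pos[of i] by simp
    qed
  qed
  then show "eventually (\<lambda>n. continuous_on UNIV
      (\<lambda>y. 1 + (\<Sum>i\<in>{- int n..int n}. slope_term i y))) sequentially"
    by (intro always_eventually allI continuous_intros)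
  show "uniform_limit UNIV (\<lambda>n y. 1 + (\<Sum>i\<in>{- int n..int n}. slope_term i y)) slope sequentially"
  proof (rule uniform_limitI)
    fix e :: real assume "0 < e"
    then have "eventually (\<lambda>n. \<forall>y. \<bar>1 + (\<Sum>i\<in>{- int n..int n}. slope_term i y) - slope y\<bar> \<le> e / 2)
        sequentially" by (intro slope_partial_sums) simp
    then show "\<forall>\<^sub>F n in sequentially. \<forall>y\<in>UNIV.
        dist (1 + (\<Sum>i\<in>{- int n..int n}. slope_term i y)) (slope y) < e"
    proof eventually_elim
      case (elim n)
      show ?case
      proof
        fix y
        show "dist (1 + (\<Sum>i\<in>{- int n..int n}. slope_term i y)) (slope y) < e"
          using elim[rule_format, of y] \<open>0 < e\<close> by (simp add: dist_real_def)
      qed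
    qed
  qed
qed simp

lemma has_derivative_lift: "(lift has_real_derivative slope y) (at y)"
proof -
  define f where "f n y = y + slack * \<theta> + (\<Sum>i\<in>{- int n..int n}. disp y i)" for n y
  define f' where "f' n y = 1 + (\<Sum>i\<in>{- int n..int n}. slope_term i y)" for n y
  have disp_deriv: "((\<lambda>y. disp y i) has_real_derivative slope_term i y) (at y)" for y i
  proof -
    have "((\<lambda>y. y - gap_start i) has_real_derivative 1) (at y)" by (auto intro!: derivative_eq_intros)
    from DERIV_chain2[OF has_derivative_stair[OF l_pos l_less_1] this]
    have "((\<lambda>y. stair (l i) (y - gap_start i)) has_real_derivative
        bump (frac (y - gap_start i) / l i) / l i) (at y)" by simp
    then have "((\<lambda>y. disp y i) has_real_derivative
        l (i + 1) * (bump (frac (y - gap_start i) / l i) / l i)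
        - l i * (bump (frac (y - gap_start i) / l i) / l i)) (at y)"
      unfolding disp_def level_def by (auto intro!: derivative_eq_intros)
    moreover have "l (i + 1) * (bump (frac (y - gap_start i) / l i) / l i)
        - l i * (bump (frac (y - gap_start i) / l i) / l i) = slope_term i y"
      using l_pos[of i] by (simp add: slope_term_def left_diff_distrib)
    ultimately show ?thesis by simp
  qed
  have lim: "(\<lambda>n. f n y) \<longlonglongrightarrow> lift y" for y
  proof -
    have "(sum (disp y) \<longlongrightarrow> (\<Sum>\<^sub>\<infinity>i. disp y i)) (finite_subsets_at_top UNIV)"
      using has_sum_infsum[OF disp_summable] by (simp add: has_sum_def)
    from filterlim_compose[OF this filterlim_symmetric_int_intervals]
    show ?thesis unfolding f_def lift_def by (intro tendsto_add tendsto_const) simp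
  qed
  have "\<exists>g. \<forall>x\<in>UNIV. (\<lambda>n. f n x) \<longlonglongrightarrow> g x \<and> (g has_derivative (\<lambda>h. slope x * h)) (at x within UNIV)"
  proof (rule has_derivative_sequence[where f' = "\<lambda>n x h. f' n x * h" and ?x0.0 = 0])
    show "(f n has_derivative (\<lambda>h. f' n x * h)) (at x within UNIV)" for n x
    proof -
      have "(f n has_real_derivative f' n x) (at x)"
        unfolding f_def[abs_def] f'_def by (auto intro!: derivative_eq_intros disp_deriv)
      then show ?thesis by (simp add: has_field_derivative_def)
    qed
    show "\<forall>\<^sub>F n in sequentially. \<forall>x\<in>UNIV. \<forall>h. norm (f' n x * h - slope x * h) \<le> e * norm h"
      if "0 < e" for e
      using slope_partial_sums[OF that]
    proof eventually_elim
      case (elim n)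
      show ?case
      proof (intro ballI allI)
        fix x h
        have "\<bar>f' n x - slope x\<bar> * \<bar>h\<bar> \<le> e * \<bar>h\<bar>"
          using elim by (intro mult_right_mono) (auto simp: f'_def)
        then show "norm (f' n x * h - slope x * h) \<le> e * norm h"
          by (simp add: abs_mult[symmetric] left_diff_distrib)
      qed
    qed
    show "(\<lambda>n. f n 0) \<longlonglongrightarrow> lift 0" by (rule lim)
  qed auto
  then obtain g where g: "\<And>x. (\<lambda>n. f n x) \<longlonglongrightarrow> g x"
    "\<And>x. (g has_derivative (\<lambda>h. slope x * h)) (at x)" by auto
  have "g = lift" using g(1) lim LIMSEQ_unique by blast
  with g(2) show ?thesis by (simp add: has_field_derivative_def)
qed

lemma lift_strict_mono: "strict_mono lift"
proof (rule strict_monoI)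
  fix x y :: real assume "x < y"
  then show "lift x < lift y"
  proof (rule DERIV_pos_imp_increasing)
    fix z
    show "\<exists>d. (lift has_real_derivative d) (at z) \<and> 0 < d"
      using has_derivative_lift[of z] slope_ge[of z] by (intro exI[of _ "slope z"]) auto
  qed
qed

lemma lift_continuous: "continuous_on S lift"
  using has_derivative_lift DERIV_continuous_on by (metis DERIV_isCont continuous_at_imp_continuous_on)

section \<open>The semiconjugacy to the rotation and the rotation number\<close>

lemma collapse_lift: "collapse (lift y) = collapse y + \<theta>"
proof (rule collapse_unique)
  have mono: "mono lift" using lift_strict_mono by (rule strict_mono_mono)
  show "phi_left (collapse y + \<theta>) \<le> lift y"
    using monoD[OF mono collapse_between(1)[of y]] by (simp add: lift_phi)
  show "lift y \<le> phi_right (collapse y + \<theta>)"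
    using monoD[OF mono collapse_between(2)[of y]] by (simp add: lift_phi)
qed

lemma collapse_funpow: "collapse ((lift ^^ n) y) = collapse y + of_nat n * \<theta>"
  by (induction n) (simp_all add: collapse_lift algebra_simps)

text \<open>The collapsing map is within 2 of the identity and turns iteration into adding
  \<open>\<theta>\<close>, so \<open>n\<close> steps move a point by \<open>n * \<theta>\<close> up
  to an error bounded independently of \<open>n\<close>.\<close>

lemma lift_rotation: "(\<lambda>n. (lift ^^ n) x / real n) \<longlonglongrightarrow> \<theta>"
proof -
  have "(\<lambda>n. ((lift ^^ n) x - real n * \<theta>) / real n) \<longlonglongrightarrow> 0"
  proof (rule tendsto_0_le)
    show "(\<lambda>n. 1 / real n) \<longlonglongrightarrow> 0" by (rule lim_1_over_n)
    have "\<bar>(lift ^^ n) x - real n * \<theta>\<bar> \<le> \<bar>collapse x\<bar> + 2" for n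
      using collapse_near[of "(lift ^^ n) x"] collapse_funpow[of n x] by linarith
    then show "eventually (\<lambda>n. norm (((lift ^^ n) x - real n * \<theta>) / real n)
        \<le> norm (1 / real n) * (\<bar>collapse x\<bar> + 2)) sequentially"
      by (intro always_eventually allI) (auto simp: abs_divide divide_right_mono)
  qed
  then have "(\<lambda>n. ((lift ^^ n) x - real n * \<theta>) / real n + \<theta>) \<longlonglongrightarrow> 0 + \<theta>"
    by (intro tendsto_add tendsto_const)
  moreover have "eventually (\<lambda>n. ((lift ^^ n) x - real n * \<theta>) / real n + \<theta> = (lift ^^ n) x / real n)
      sequentially"
    using eventually_gt_at_top[of 0] by eventually_elim (simp add: diff_divide_distrib)
  ultimately show ?thesis by (simp add: tendsto_cong)
qed

lemma lift_surj: "surj lift"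
proof -
  have "\<exists>y. lift y = z" for z
  proof -
    have lift_near: "\<bar>lift y - y\<bar> \<le> \<bar>\<theta>\<bar> + 4" for y
      using collapse_near[of y] collapse_near[of "lift y"] collapse_lift[of y] by linarith
    have "lift (z - \<bar>\<theta>\<bar> - 4) \<le> z" "z \<le> lift (z + \<bar>\<theta>\<bar> + 4)"
      using lift_near[of "z - \<bar>\<theta>\<bar> - 4"] lift_near[of "z + \<bar>\<theta>\<bar> + 4"] by linarith+
    then show ?thesis
      using IVT'[of lift "z - \<bar>\<theta>\<bar> - 4" z "z + \<bar>\<theta>\<bar> + 4"] lift_continuous by auto
  qed
  then show ?thesis by (metis surjI)
qed

lemma lift_gap_start: "lift (gap_start i) = gap_start (i + 1)"
  "lift (gap_start i + l i) = gap_start (i + 1) + l (i + 1)"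
proof -
  have eq: "of_int i * \<theta> + \<theta> = of_int (i + 1) * \<theta>" by (simp add: algebra_simps)
  show "lift (gap_start i) = gap_start (i + 1)"
    unfolding gap_start_def lift_phi eq ..
  have "gap_start i + l i = phi_right (of_int i * \<theta>)" for i
    using phi_right_gap[of i 0] by simp
  then show "lift (gap_start i + l i) = gap_start (i + 1) + l (i + 1)"
    by (simp only: lift_phi eq)
qed

end

subsection \<open>Maps of the circle\<close>

lemma circle_of_rep [simp]: "circle_of (rep_circle p) = p"
  by (rule Quotient_abs_rep[OF Quotient_circle])

lemma dist_circle_of: "dist (circle_of x) (circle_of y) = int_dist (x - y)"
  by (simp add: dist_circle.abs_eq)

lemma dist_circle_of_le: "dist (circle_of x) (circle_of y) \<le> \<bar>x - y\<bar>"
  using int_dist_le[of "x - y" 0] by (simp add: dist_circle_of)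

lemma circle_of_add_int [simp]: "circle_of (x + of_int k) = circle_of x"
  by (simp add: circle_of_eq_iff)

text \<open>Rounding the difference of representatives selects the lift of \<open>q\<close> nearest
  to \<open>x\<close>. Estimates on the line then carry over to the circle with the same
  distance.\<close>

lemma circle_nearest_rep:
  obtains y where "q = circle_of y" "dist (circle_of x) q = \<bar>x - y\<bar>"
proof
  let ?k = "round (x - rep_circle q)"
  show "q = circle_of (rep_circle q + of_int ?k)" by simp
  have "dist (circle_of x) (circle_of (rep_circle q)) = \<bar>x - (rep_circle q + of_int ?k)\<bar>"
    unfolding dist_circle_of int_dist_def by (simp add: algebra_simps)
  then show "dist (circle_of x) q = \<bar>x - (rep_circle q + of_int ?k)\<bar>" by simp
qed

lemma continuous_on_circle_of: "continuous_on S circle_of"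
proof (rule continuous_on_subset[of UNIV])
  show "continuous_on UNIV circle_of"
    unfolding continuous_on_iff
  proof (intro ballI allI impI)
    fix x e :: real assume "0 < e"
    then show "\<exists>d>0. \<forall>y\<in>UNIV. dist y x < d \<longrightarrow> dist (circle_of y) (circle_of x) < e"
      using dist_circle_of_le by (intro exI[of _ e]) (auto simp: dist_real_def intro: le_less_trans)
  qed
qed simp

lemma continuous_on_circleI:
  fixes g :: "circle \<Rightarrow> 'a::metric_space"
  assumes "continuous_on UNIV (\<lambda>x. g (circle_of x))"
  shows "continuous_on UNIV g"
  unfolding continuous_on_iff
proof (intro ballI allI impI)
  fix p :: circle and e :: real assume "0 < e"
  define x where "x = rep_circle p"
  have p: "p = circle_of x" by (simp add: x_def)
  obtain d where d: "0 < d" "\<And>y. dist y x < d \<Longrightarrow> dist (g (circle_of y)) (g (circle_of x)) < e"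
    using assms \<open>0 < e\<close> unfolding continuous_on_iff by blast
  have "dist (g q) (g p) < e" if "dist q p < d" for q
  proof -
    obtain y where "q = circle_of y" "dist (circle_of x) q = \<bar>x - y\<bar>" by (rule circle_nearest_rep)
    then show ?thesis using d(2)[of y] that
      by (simp add: p dist_commute dist_real_def abs_minus_commute)
  qed
  with d(1) show "\<exists>d>0. \<forall>q\<in>UNIV. dist q p < d \<longrightarrow> dist (g q) (g p) < e" by blast
qed

text \<open>Built on a chosen representative, hence meaningful for \<open>F\<close> of degree one,
  where \<open>circle_map_circle_of\<close> removes the choice.\<close>

definition circle_map :: "(real \<Rightarrow> real) \<Rightarrow> circle \<Rightarrow> circle" where
  "circle_map F p = circle_of (F (rep_circle p))"

definition circle_fun :: "(real \<Rightarrow> 'a) \<Rightarrow> circle \<Rightarrow> 'a" where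
  "circle_fun g p = g (rep_circle p)"

lemma rep_circle_of: obtains k where "rep_circle (circle_of x) = x + of_int k"
proof -
  have "rep_circle (circle_of x) - x \<in> \<int>"
    by (simp add: circle_of_eq_iff[symmetric])
  then show thesis using that by (auto elim!: Ints_cases simp: algebra_simps)
qed

lemma circle_map_circle_of:
  assumes "\<And>x. F (x + 1) = F x + 1"
  shows "circle_map F (circle_of x) = circle_of (F x)"
proof -
  obtain k where "rep_circle (circle_of x) = x + of_int k" by (rule rep_circle_of)
  then show ?thesis using degree_one_add_int[of F, OF assms] by (simp add: circle_map_def)
qed

lemma circle_fun_circle_of:
  assumes "\<And>x. g (x + 1) = g x"
  shows "circle_fun g (circle_of x) = g x"
proof -
  obtain k where "rep_circle (circle_of x) = x + of_int k" by (rule rep_circle_of)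
  then show ?thesis using periodic_add_int[of g, OF assms] by (simp add: circle_fun_def)
qed

lemma lift_of_circle_map:
  assumes "\<And>x. F (x + 1) = F x + 1" "continuous_on UNIV F"
  shows "lift_of F (circle_map F)"
  using assms by (simp add: lift_of_def circle_map_circle_of)

lemma C1_with_derivative_circle_map:
  assumes F: "\<And>x. F (x + 1) = F x + 1" and g: "\<And>x. g (x + 1) = g x"
    and deriv: "\<And>x. (F has_real_derivative g x) (at x)" and cont: "continuous_on UNIV g"
  shows "C1_with_derivative (circle_map F) (circle_fun g)"
  unfolding C1_with_derivative_def
proof (intro conjI allI)
  show "continuous_on UNIV (circle_fun g)"
    using cont by (intro continuous_on_circleI) (simp add: circle_fun_circle_of g)
  have "continuous_on UNIV F" using deriv DERIV_continuous_on by blast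
  then show "has_circle_derivative (circle_map F) (circle_fun g p) p" for p
    unfolding has_circle_derivative_def circle_fun_def
    using lift_of_circle_map[of F, OF F] deriv
    by (intro exI[of _ F] exI[of _ "rep_circle p"]) auto
qed

lemma alpha_continuous_circle_fun:
  assumes \<alpha>: "concave_modulus \<alpha>" and g: "\<And>x. g (x + 1) = g x"
    and holder: "\<And>x y. \<bar>g x - g y\<bar> \<le> C * \<alpha> \<bar>x - y\<bar>"
  shows "alpha_continuous \<alpha> (circle_fun g)"
  unfolding alpha_continuous_def
proof (rule bdd_aboveI, safe)
  fix p q :: circle assume "p \<noteq> q"
  define x where "x = rep_circle p"
  have p: "p = circle_of x" by (simp add: x_def)
  obtain y where y: "q = circle_of y" "dist (circle_of x) q = \<bar>x - y\<bar>" by (rule circle_nearest_rep)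
  have "0 < \<bar>x - y\<bar>" using \<open>p \<noteq> q\<close> y p by auto
  then have "0 < \<alpha> (dist p q)" using concave_modulus_pos[OF \<alpha>] y p by simp
  then show "\<bar>circle_fun g p - circle_fun g q\<bar> / \<alpha> (dist p q) \<le> C"
    using holder[of x y] y p by (simp add: circle_fun_circle_of g divide_le_eq)
qed

lemma strict_mono_surj_inv:
  fixes F :: "real \<Rightarrow> real"
  assumes "strict_mono F" "surj F"
  shows "inv F (F x) = x" "F (inv F y) = y"
  using strict_mono_imp_inj_on[OF assms(1)] assms(2) by (simp_all add: surj_f_inv_f)

text \<open>The inverse of the lift again has degree one, and its derivative is the reciprocal of a
  positive continuous function; so it descends to a C^1 inverse of the circle map.\<close>

lemma circle_diffeo:
  assumes F: "\<And>x. F (x + 1) = F x + 1" and g: "\<And>x. g (x + 1) = g x"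
    and deriv: "\<And>x. (F has_real_derivative g x) (at x)" and cont: "continuous_on UNIV g"
    and pos: "\<And>x. 0 < g x" and mono: "strict_mono F" and surj: "surj F"
    and alpha: "alpha_continuous \<alpha> (circle_fun g)"
  shows "circle_map F \<in> Diff_plus_1 \<alpha>"
proof -
  note inv = strict_mono_surj_inv[OF mono surj]
  let ?G = "inv F"
  have G: "?G (y + 1) = ?G y + 1" for y
    using F[of "?G y"] inv by metis
  have contF: "continuous_on UNIV F" using deriv DERIV_continuous_on by blast
  have isContF: "isCont F x" for x using deriv DERIV_isCont by blast
  have isContG: "isCont ?G y" for y
  proof -
    have "isCont ?G (F (?G y))"
      by (rule isCont_inverse_function2[of "?G y - 1" _ "?G y + 1"]) (auto simp: inv isContF)
    then show ?thesis by (simp add: inv)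
  qed
  have derivG: "(?G has_real_derivative inverse (g (?G y))) (at y)" for y
    by (rule DERIV_inverse_function[where f = F and a = "y - 1" and b = "y + 1"])
      (use pos[of "?G y"] in \<open>auto simp: inv deriv isContG\<close>)
  have contG: "continuous_on UNIV ?G" using isContG by (simp add: continuous_at_imp_continuous_on)
  have GF: "circle_map ?G (circle_map F p) = p" "circle_map F (circle_map ?G p) = p" for p
    using circle_map_circle_of[of F, OF F] circle_map_circle_of[of ?G, OF G] inv
    by (metis circle_map_def circle_of_rep)+
  have bij: "bij (circle_map F)" by (rule o_bij[of "circle_map ?G"]) (auto simp: GF)
  have inv_eq: "Hilbert_Choice.inv (circle_map F) = circle_map ?G"
    using GF by (intro inv_equality)
  have "continuous_on UNIV (\<lambda>y. inverse (g (?G y)))"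
    using pos continuous_on_compose2[OF cont contG] by (intro continuous_on_inverse) (auto simp: less_imp_neq[symmetric])
  then have "C1_with_derivative (circle_map ?G) (circle_fun (\<lambda>y. inverse (g (?G y))))"
    using G g derivG by (intro C1_with_derivative_circle_map) auto
  moreover have "orientation_preserving (circle_map F)"
    unfolding orientation_preserving_def using lift_of_circle_map[of F, OF F contF] mono by blast
  ultimately show ?thesis
    unfolding Diff_plus_1_def using bij C1_with_derivative_circle_map[of F g, OF F g deriv cont] alpha
    by (auto simp: inv_eq)
qed

text \<open>An arc passing an integer shows up as two pieces in the unit interval where length is
  measured. After translating \<open>a\<close> into that interval, a point \<open>x\<close> of it
  belongs to the arc only through \<open>x\<close> or \<open>x + 1\<close>.\<close>

lemma circle_length_interval:
  assumes "a \<le> b" "b \<le> a + 1"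
  shows "circle_length (circle_of ` {a<..<b}) = b - a"
proof -
  define c where "c = frac a"
  define d where "d = b - of_int \<lfloor>a\<rfloor>"
  have c: "0 \<le> c" "c < 1" by (simp_all add: c_def frac_lt_1)
  have d: "c \<le> d" "d \<le> c + 1" "d - c = b - a" using assms by (simp_all add: c_def d_def frac_def)
  define A where "A = circle_of ` {a<..<b}"
  have mem: "circle_of x \<in> A \<longleftrightarrow> (c < x \<and> x < d) \<or> (c < x + 1 \<and> x + 1 < d)"
    if x: "0 \<le> x" "x < 1" for x
  proof
    assume "circle_of x \<in> A"
    then obtain y where y: "a < y" "y < b" "circle_of x = circle_of y" by (auto simp: A_def)
    then obtain m where m: "x - y = of_int m" by (auto simp: circle_of_eq_iff elim: Ints_cases)
    define n where "n = - (m + \<lfloor>a\<rfloor>)"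
    have n: "c < x + of_int n" "x + of_int n < d"
      using y m by (auto simp: n_def c_def d_def frac_def)
    have "of_int n < (2::real)" "(-1::real) < of_int n" using n c d x by linarith+
    then have "n = 0 \<or> n = 1" by linarith
    then show "(c < x \<and> x < d) \<or> (c < x + 1 \<and> x + 1 < d)" using n by auto
  next
    assume "(c < x \<and> x < d) \<or> (c < x + 1 \<and> x + 1 < d)"
    then obtain n :: int where n: "c < x + of_int n" "x + of_int n < d"
      by (metis add.right_neutral of_int_0 of_int_1)
    then have "x + of_int (n + \<lfloor>a\<rfloor>) \<in> {a<..<b}" by (simp add: c_def d_def frac_def)
    then show "circle_of x \<in> A" unfolding A_def by (metis circle_of_add_int imageI)
  qed
  show ?thesis
  proof (cases "d \<le> 1")
    case True
    have "{x \<in> {0..<1}. circle_of x \<in> A} = {c<..<d}"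
      using c d True by (auto simp: mem)
    then show ?thesis using d by (simp add: circle_length_def A_def)
  next
    case False
    have eq: "{x \<in> {0..<1}. circle_of x \<in> A} = {c<..<1} \<union> {0..<d - 1}"
      using c d False by (auto simp: mem)
    have "emeasure lborel ({c<..<1} \<union> {0..<d - 1}) = emeasure lborel {c<..<1} + emeasure lborel {0..<d - 1}"
      using d by (intro plus_emeasure[symmetric]) auto
    also have "\<dots> = ennreal (b - a)"
      using c d False by (simp flip: ennreal_plus)
    finally show ?thesis
      unfolding circle_length_def A_def[symmetric] eq measure_def using assms by simp
  qed
qed

subsection \<open>The exceptional minimal set and the wandering gaps\<close>

context gap_lengths
begin

lemma rotation_dense:
  assumes "b < c"
  obtains i k :: int where "b < x + (of_int i * \<theta> + of_int k)" "x + (of_int i * \<theta> + of_int k) < c"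
proof -
  \<comment> \<open>The offset from \<open>x\<close> to the midpoint of the target interval, which a
    multiple of \<open>\<theta>\<close> approximates modulo 1 to within half the length.\<close>
  define m where "m = (b + c) / 2 - x"
  have "0 < (c - b) / 2" using assms by simp
  then obtain n where n: "\<bar>frac (real n * \<theta>) - frac m\<bar> < (c - b) / 2"
    using Kronecker_approx_1_explicit[OF irrational, of "frac m" "(c - b) / 2"]
    by (metis frac_ge_0 frac_lt_1 less_imp_le)
  define w where "w = x + (of_int (int n) * \<theta> + of_int (\<lfloor>m\<rfloor> - \<lfloor>real n * \<theta>\<rfloor>))"
  have "w - (b + c) / 2 = frac (real n * \<theta>) - frac m" by (simp add: w_def m_def frac_def)
  then have "\<bar>w - (b + c) / 2\<bar> < (c - b) / 2" using n by simp
  then have "b < w" "w < c" by (simp_all add: abs_less_iff field_simps)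
  then show thesis unfolding w_def by (rule that)
qed

text \<open>A single term has constant \<open>6 * C\<close>: at distances up to \<open>l i\<close>
  by its Lipschitz bound and \<open>concave_modulus_scale\<close>, beyond that by its height. If
  \<open>y\<close> and \<open>z\<close> lie in different gaps, each term vanishes at the other
  point, and the two estimates add up to \<open>12 * C\<close>.\<close>

lemma slope_holder:
  assumes \<alpha>: "concave_modulus \<alpha>"
    and C: "\<And>i. \<bar>l (i + 1) / l i - 1\<bar> \<le> C * \<alpha> (l i)"
  shows "\<bar>slope y - slope z\<bar> \<le> 12 * C * \<alpha> \<bar>y - z\<bar>"
proof -
  have C0: "0 \<le> C"
  proof -
    have "0 \<le> C * \<alpha> (l 0)" using C[of 0] by (rule order_trans[rotated]) simp
    then show ?thesis using concave_modulus_pos[OF \<alpha> l_pos[of 0]] by (simp add: zero_le_mult_iff)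
  qed
  have nonneg: "0 \<le> \<alpha> \<bar>y - z\<bar>" for y z
    using concave_modulus_mono[OF \<alpha>, of 0 "\<bar>y - z\<bar>"] concave_modulus_zero[OF \<alpha>] by simp
  have tm: "\<bar>slope_term i y - slope_term i z\<bar> \<le> 6 * (C * \<alpha> \<bar>y - z\<bar>)" for i y z
  proof (cases "\<bar>y - z\<bar> \<le> l i")
    case True
    have "\<bar>slope_term i y - slope_term i z\<bar> \<le> C * \<alpha> (l i) * (6 * (\<bar>y - z\<bar> / l i))"
      using l_pos[of i] by (intro order_trans[OF slope_term_lipschitz] mult_right_mono C) auto
    also have "\<dots> = 6 * (C * (\<bar>y - z\<bar> / l i * \<alpha> (l i)))" by (simp add: algebra_simps)
    also have "\<dots> \<le> 6 * (C * \<alpha> \<bar>y - z\<bar>)"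
      using concave_modulus_scale[OF \<alpha> _ True l_pos] C0 by (intro mult_left_mono) auto
    finally show ?thesis .
  next
    case False
    have r: "\<bar>l (i + 1) / l i - 1\<bar> \<le> C * \<alpha> \<bar>y - z\<bar>"
      using C0 False l_pos[of i]
      by (intro order_trans[OF C] mult_left_mono concave_modulus_mono[OF \<alpha>]) auto
    have *: "\<bar>slope_term i x\<bar> \<le> C * \<alpha> \<bar>y - z\<bar> * (3 / 2)" for x
      by (intro order_trans[OF slope_term_le] mult_right_mono r) simp
    have "0 \<le> C * \<alpha> \<bar>y - z\<bar>" using C0 nonneg by simp
    then show ?thesis using *[of y] *[of z] by linarith
  qed
  have one: "\<bar>slope y - slope z\<bar> \<le> 6 * (C * \<alpha> \<bar>y - z\<bar>)"
    if "slope_term i y \<noteq> 0" "\<And>j. slope_term j z \<noteq> 0 \<Longrightarrow> j = i" for i y z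
  proof (cases "slope_term i z = 0")
    case True
    then have "slope z = 1" using that(2) by (intro slope_eq_1) blast
    then show ?thesis using tm[of i y z] slope_eq[OF that(1)] True by simp
  next
    case False
    then show ?thesis using tm[of i y z] slope_eq[OF that(1)] slope_eq[OF False] by simp
  qed
  show ?thesis
  proof (cases "\<exists>i. slope_term i y \<noteq> 0")
    case True
    then obtain i where i: "slope_term i y \<noteq> 0" by blast
    show ?thesis
    proof (cases "\<exists>j. slope_term j z \<noteq> 0")
      case True
      then obtain j where j: "slope_term j z \<noteq> 0" by blast
      show ?thesis
      proof (cases "i = j")
        case True
        then show ?thesis using one[OF i, of z] slope_term_unique[OF j] C0 nonneg[of y z] by force
      next
        case False
        then have "slope_term j y = 0" "slope_term i z = 0"
          using i j slope_term_unique by blast+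
        then have "\<bar>slope_term i y\<bar> \<le> 6 * (C * \<alpha> \<bar>y - z\<bar>)" "\<bar>slope_term j z\<bar> \<le> 6 * (C * \<alpha> \<bar>y - z\<bar>)"
          using tm[of i y z] tm[of j y z] by simp_all
        then show ?thesis using slope_eq[OF i] slope_eq[OF j] by (simp add: abs_le_iff)
      qed
    next
      case False
      then have "\<bar>slope y - slope z\<bar> \<le> 6 * (C * \<alpha> \<bar>y - z\<bar>)" by (intro one[OF i]) auto
      moreover have "0 \<le> C * \<alpha> \<bar>y - z\<bar>" using C0 nonneg by simp
      ultimately show ?thesis by linarith
    qed
  next
    case False
    then have y: "slope y = 1" by (intro slope_eq_1) auto
    have nn: "0 \<le> C * \<alpha> \<bar>y - z\<bar>" using C0 nonneg by simp
    show ?thesis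
    proof (cases "\<exists>j. slope_term j z \<noteq> 0")
      case True
      then obtain j where j: "slope_term j z \<noteq> 0" by blast
      have "\<bar>slope z - slope y\<bar> \<le> 6 * (C * \<alpha> \<bar>z - y\<bar>)" using False by (intro one[OF j]) auto
      then show ?thesis using nn by (simp add: abs_minus_commute)
    next
      case no: False
      then have "slope z = 1" by (intro slope_eq_1) auto
      then show ?thesis using y nn by simp
    qed
  qed
qed

section \<open>The invariant closed set and its gaps on the line\<close>

definition line_gap :: "int \<Rightarrow> int \<Rightarrow> real set" where
  "line_gap i k = {gap_start i + of_int k<..<gap_start i + of_int k + l i}"

definition line_set :: "real set" where
  "line_set = range phi_left \<union> range phi_right"

lemma line_gap_eq: "line_gap i k =
    {phi_left (of_int i * \<theta> + of_int k)<..<phi_right (of_int i * \<theta> + of_int k)}"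
  by (simp add: line_gap_def phi_left_gap phi_right_gap)

lemma collapse_line_gap: "y \<in> line_gap i k \<Longrightarrow> collapse y = of_int i * \<theta> + of_int k"
  by (intro collapse_unique) (auto simp: line_gap_eq)

lemma line_gap_unique: "y \<in> line_gap i k \<Longrightarrow> y \<in> line_gap j m \<Longrightarrow> i = j \<and> k = m"
  using collapse_line_gap[of y i k] collapse_line_gap[of y j m] by (simp add: rotation_eq_iff)

text \<open>A point lies between the two ends belonging to its collapse, and these differ only at
  orbit points, where they bound a gap. The description by gaps yields closedness, the one by the
  blow-up maps invariance.\<close>

lemma line_set_iff: "y \<in> line_set \<longleftrightarrow> (\<forall>i k. y \<notin> line_gap i k)"
proof
  assume "y \<in> line_set"
  then obtain x where x: "y = phi_left x \<or> y = phi_right x" by (auto simp: line_set_def)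
  have *: "collapse y = x" using x phi_left_le_right[of x] by (auto intro: collapse_unique)
  show "\<forall>i k. y \<notin> line_gap i k"
  proof (intro allI notI)
    fix i k assume gap: "y \<in> line_gap i k"
    then have "x = of_int i * \<theta> + of_int k" using collapse_line_gap * by simp
    with gap x show False by (auto simp: line_gap_eq)
  qed
next
  assume no: "\<forall>i k. y \<notin> line_gap i k"
  let ?x = "collapse y"
  show "y \<in> line_set"
  proof (cases "\<exists>i k. ?x = of_int i * \<theta> + of_int k")
    case True
    then obtain i k where ik: "?x = of_int i * \<theta> + of_int k" by blast
    have "y \<notin> {phi_left ?x<..<phi_right ?x}" using no unfolding ik line_gap_eq by blast
    then have "y = phi_left ?x \<or> y = phi_right ?x" using collapse_between[of y] by auto
    then show ?thesis by (auto simp: line_set_def)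
  next
    case False
    then have "phi_right ?x = phi_left ?x" by (intro phi_no_gap) blast
    then have "y = phi_left ?x" using collapse_between[of y] by simp
    then show ?thesis by (auto simp: line_set_def)
  qed
qed

lemma line_set_cases:
  assumes "y \<in> line_set"
  shows "y = phi_left (collapse y) \<or> y = phi_right (collapse y)"
proof -
  obtain x where x: "y = phi_left x \<or> y = phi_right x"
    using assms unfolding line_set_def by blast
  then have "collapse y = x" using phi_left_le_right[of x] by (auto intro: collapse_unique)
  with x show ?thesis by simp
qed

lemma line_set_add_int: "y + of_int m \<in> line_set \<longleftrightarrow> y \<in> line_set"
proof -
  have *: "y + of_int m \<in> line_set" if y: "y \<in> line_set" for y m
  proof -
    obtain x where "y = phi_left x \<or> y = phi_right x" using y unfolding line_set_def by blast
    then have "y + of_int m = phi_left (x + of_int m) \<or> y + of_int m = phi_right (x + of_int m)"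
      by (auto simp: phi_add_int)
    then show ?thesis by (auto simp: line_set_def)
  qed
  show ?thesis using *[of y m] *[of "y + of_int m" "- m"] by auto
qed

lemma closed_line_set: "closed line_set"
proof -
  have "line_set = - (\<Union>i. \<Union>k. line_gap i k)" using line_set_iff by auto
  moreover have "open (\<Union>i. \<Union>k. line_gap i k)" by (intro open_UN ballI) (simp add: line_gap_def)
  ultimately show ?thesis by (simp add: closed_def)
qed

lemma lift_line_set: "lift ` line_set = line_set"
proof
  show "lift ` line_set \<subseteq> line_set" by (auto simp: line_set_def lift_phi)
  show "line_set \<subseteq> lift ` line_set"
  proof
    fix y assume "y \<in> line_set"
    then obtain x where "y = phi_left x \<or> y = phi_right x" by (auto simp: line_set_def)
    then have "y = lift (phi_left (x - \<theta>)) \<or> y = lift (phi_right (x - \<theta>))" by (simp add: lift_phi)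
    then show "y \<in> lift ` line_set" by (auto simp: line_set_def)
  qed
qed

section \<open>The map, the Cantor set and the gaps on the circle\<close>

definition denjoy :: "circle \<Rightarrow> circle" where
  "denjoy = circle_map lift"

definition cantor :: "circle set" where
  "cantor = circle_of ` line_set"

definition gap :: "int \<Rightarrow> circle set" where
  "gap i = circle_of ` {gap_start i<..<gap_start i + l i}"

lemma denjoy_circle_of: "denjoy (circle_of y) = circle_of (lift y)"
  unfolding denjoy_def by (rule circle_map_circle_of) (rule lift_add_1)

lemma circle_of_in_cantor: "circle_of y \<in> cantor \<longleftrightarrow> y \<in> line_set"
proof
  assume "circle_of y \<in> cantor"
  then obtain z where z: "z \<in> line_set" "y - z \<in> \<int>" by (auto simp: cantor_def circle_of_eq_iff)
  then obtain m where "y = z + of_int m" by (auto elim!: Ints_cases simp: algebra_simps)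
  then show "y \<in> line_set" using z line_set_add_int by simp
qed (simp add: cantor_def)

lemma circle_of_in_gap: "circle_of y \<in> gap i \<longleftrightarrow> (\<exists>k. y \<in> line_gap i k)"
proof
  assume "circle_of y \<in> gap i"
  then obtain z where z: "z \<in> {gap_start i<..<gap_start i + l i}" "y - z \<in> \<int>"
    by (auto simp: gap_def circle_of_eq_iff)
  then obtain m where "y = z + of_int m" by (auto elim!: Ints_cases simp: algebra_simps)
  then show "\<exists>k. y \<in> line_gap i k" using z
    by (intro exI[of _ m]) (auto simp: line_gap_def)
next
  assume "\<exists>k. y \<in> line_gap i k"
  then obtain k where "y \<in> line_gap i k" ..
  then have "y + of_int (- k) \<in> {gap_start i<..<gap_start i + l i}" by (auto simp: line_gap_def)
  then show "circle_of y \<in> gap i" unfolding gap_def by (metis circle_of_add_int imageI)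
qed

lemma denjoy_cantor: "denjoy ` cantor = cantor"
proof -
  have "denjoy ` cantor = circle_of ` lift ` line_set"
    by (simp add: cantor_def image_image denjoy_circle_of)
  then show ?thesis by (simp add: lift_line_set cantor_def)
qed

lemma denjoy_gap: "denjoy ` gap i = gap (i + 1)"
proof -
  note inv = strict_mono_surj_inv[OF lift_strict_mono lift_surj]
  have "lift ` {a<..<b} = {lift a<..<lift b}" for a b
  proof
    show "lift ` {a<..<b} \<subseteq> {lift a<..<lift b}"
      using strict_monoD[OF lift_strict_mono] by auto
    show "{lift a<..<lift b} \<subseteq> lift ` {a<..<b}"
    proof
      fix y assume "y \<in> {lift a<..<lift b}"
      then have "inv lift y \<in> {a<..<b}"
        using strict_mono_less[OF lift_strict_mono, of a "inv lift y"]
          strict_mono_less[OF lift_strict_mono, of "inv lift y" b] inv by simp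
      then show "y \<in> lift ` {a<..<b}" using inv(2)[of y] by (metis imageI)
    qed
  qed
  moreover have "denjoy ` gap i = circle_of ` lift ` {gap_start i<..<gap_start i + l i}"
    by (simp add: gap_def image_image denjoy_circle_of)
  ultimately show ?thesis by (simp only: gap_def lift_gap_start)
qed

text \<open>One period of the set, cut at a gap so that \<open>circle_of\<close> is injective on a
  compact piece. The Cantor property can then be proved with the order of the line.\<close>

definition fund :: "real set" where
  "fund = line_set \<inter> {phi_right 0..phi_left 1}"

lemma phi_0_1: "phi_right 0 = gap_start 0 + l 0" "phi_left 1 = gap_start 0 + 1"
  using phi_right_gap[of 0 0] phi_left_gap[of 0 1] by simp_all

lemma compact_fund: "compact fund"
  unfolding fund_def by (intro closed_Int_compact closed_line_set) simp

lemma circle_of_fund: "circle_of ` fund = cantor"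
proof
  show "circle_of ` fund \<subseteq> cantor" by (auto simp: fund_def cantor_def)
  show "cantor \<subseteq> circle_of ` fund"
  proof
    fix p assume "p \<in> cantor"
    then obtain y where y: "y \<in> line_set" "p = circle_of y" by (auto simp: cantor_def)
    define z where "z = y + of_int (- \<lfloor>y - gap_start 0\<rfloor>)"
    have z: "z \<in> line_set" "p = circle_of z"
      unfolding z_def using y line_set_add_int[of y "- \<lfloor>y - gap_start 0\<rfloor>"]
        circle_of_add_int[of y "- \<lfloor>y - gap_start 0\<rfloor>"] by simp_all
    have b: "gap_start 0 \<le> z" "z < gap_start 0 + 1" unfolding z_def by linarith+
    have "z \<notin> line_gap 0 0" using z line_set_iff by blast
    then consider "z = gap_start 0" | "gap_start 0 + l 0 \<le> z" using b by (auto simp: line_gap_def)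
    then show "p \<in> circle_of ` fund"
    proof cases
      \<comment> \<open>The left end of gap 0 lies before the chosen period; its translate by 1 is
        the upper end \<open>phi_left 1\<close>.\<close>
      case 1
      then have "z + of_int 1 \<in> fund"
        using z line_set_add_int[of z 1] l_less_1[of 0] by (simp add: fund_def phi_0_1)
      then show ?thesis using z circle_of_add_int[of z 1] by (metis imageI)
    next
      case 2
      then have "z \<in> fund" using z b by (simp add: fund_def phi_0_1)
      then show ?thesis using z by blast
    qed
  qed
qed

lemma inj_on_circle_of_fund: "inj_on circle_of fund"
proof (rule inj_onI)
  fix x y assume xy: "x \<in> fund" "y \<in> fund" "circle_of x = circle_of y"
  then obtain m where m: "x - y = of_int m" by (auto simp: circle_of_eq_iff elim: Ints_cases)
  have "\<bar>x - y\<bar> < 1" using xy l_pos[of 0] by (auto simp: fund_def phi_0_1 abs_less_iff)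
  then have "m = 0" using m by simp
  then show "x = y" using m by simp
qed

lemma cantor_homeomorphic_fund: "cantor homeomorphic fund"
  using homeomorphic_compact[OF compact_fund continuous_on_circle_of circle_of_fund inj_on_circle_of_fund]
    homeomorphic_sym by blast

lemma closed_cantor: "closed cantor"
proof -
  have "compact (circle_of ` fund)" by (intro compact_continuous_image continuous_on_circle_of compact_fund)
  then show ?thesis by (simp add: circle_of_fund compact_imp_closed)
qed

text \<open>If the collapses differ, density puts an orbit point between them. If they agree,
  \<open>x\<close> and \<open>y\<close> are the ends of one gap and \<open>x\<close> itself is the
  separating left end, hence the first inequality is not strict.\<close>

lemma fund_separated:
  assumes "x \<in> line_set" "y \<in> line_set" "x < y"
  obtains i k where "x \<le> phi_left (of_int i * \<theta> + of_int k)" "phi_left (of_int i * \<theta> + of_int k) < y"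
proof (cases "collapse x" "collapse y" rule: linorder_cases)
  case less
  obtain i k where ik: "collapse x < 0 + (of_int i * \<theta> + of_int k)" "0 + (of_int i * \<theta> + of_int k) < collapse y"
    using rotation_dense[OF less] .
  have "x \<le> phi_left (of_int i * \<theta> + of_int k)"
    using collapse_between(2)[of x] phi_less[OF ik(1)] by simp
  moreover have "phi_left (of_int i * \<theta> + of_int k) < y"
    using collapse_between(1)[of y] phi_less[OF ik(2)] phi_left_le_right[of "of_int i * \<theta> + of_int k"]
    by simp
  ultimately show ?thesis by (rule that)
next
  case equal
  then have e: "x = phi_left (collapse x)" "y = phi_right (collapse x)"
    using line_set_cases[OF assms(1)] line_set_cases[OF assms(2)] assms(3)
      collapse_between[of x] collapse_between[of y] by auto
  then have "phi_right (collapse x) \<noteq> phi_left (collapse x)" using assms(3) by simp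
  then obtain i k where "collapse x = of_int i * \<theta> + of_int k" using phi_no_gap by blast
  then show ?thesis using that[of i k] e assms(3) by simp
next
  case greater
  then show ?thesis
    using phi_less[OF greater] collapse_between(1)[of x] collapse_between(2)[of y] assms(3) by simp
qed

text \<open>A left end is approached by right ends from below, a right end by left ends from above.
  To remain in the period, the former must collapse above 0 and the latter below 1.\<close>

lemma fund_perfect:
  assumes V: "openin (top_of_set fund) V" "y \<in> V"
  shows "\<exists>z\<in>V. z \<noteq> y"
proof -
  obtain T where T: "open T" "V = fund \<inter> T" using V(1) by (auto simp: openin_open)
  have y: "y \<in> line_set" "phi_right 0 \<le> y" "y \<le> phi_left 1" "y \<in> T"
    using V(2) T by (auto simp: fund_def)
  let ?x = "collapse y"
  consider "y = phi_left ?x" | "y = phi_right ?x" using line_set_cases[OF y(1)] by blast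
  then show ?thesis
  proof cases
    case 1
    have "0 < ?x"
    proof (rule ccontr)
      assume "\<not> 0 < ?x"
      then have "phi_left ?x \<le> phi_left 0" by (intro phi_left_mono) simp
      then show False using 1 y(2) l_pos[of 0] phi_0_1 by (simp add: gap_start_def)
    qed
    then have "eventually (\<lambda>t. t \<in> {0<..<?x}) (at_left ?x)" by (rule eventually_at_left_real)
    moreover have "eventually (\<lambda>t. phi_right t \<in> T) (at_left ?x)"
      using topological_tendstoD[OF tendsto_phi_left T(1)] y(4) 1 by simp
    ultimately have "eventually (\<lambda>t. t \<in> {0<..<?x} \<and> phi_right t \<in> T) (at_left ?x)"
      by eventually_elim simp
    then obtain t where t: "0 < t" "t < ?x" "phi_right t \<in> T"
      using eventually_happens[of _ "at_left ?x"] by auto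
    have "phi_right t < y" using phi_less[OF t(2)] 1 by simp
    moreover have "phi_right 0 \<le> phi_right t" using t by (intro phi_right_mono) simp
    ultimately have "phi_right t \<in> fund" using y(3) by (auto simp: fund_def line_set_def)
    then show ?thesis using t T \<open>phi_right t < y\<close> by (intro bexI[of _ "phi_right t"]) auto
  next
    case 2
    have "?x < 1"
    proof (rule ccontr)
      assume "\<not> ?x < 1"
      then have "phi_right 1 \<le> phi_right ?x" by (intro phi_right_mono) simp
      moreover have "phi_right 1 = phi_right 0 + 1" using phi_add_1(2)[of 0] by simp
      ultimately show False using 2 y(3) l_pos[of 0] phi_0_1 by simp
    qed
    then have "eventually (\<lambda>t. t \<in> {?x<..<1}) (at_right ?x)" by (rule eventually_at_right_real)
    moreover have "eventually (\<lambda>t. phi_left t \<in> T) (at_right ?x)"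
      using topological_tendstoD[OF tendsto_phi_right T(1)] y(4) 2 by simp
    ultimately have "eventually (\<lambda>t. t \<in> {?x<..<1} \<and> phi_left t \<in> T) (at_right ?x)"
      by eventually_elim simp
    then obtain t where t: "?x < t" "t < 1" "phi_left t \<in> T"
      using eventually_happens[of _ "at_right ?x"] by auto
    have "y < phi_left t" using phi_less[OF t(1)] 2 by simp
    moreover have "phi_left t \<le> phi_left 1" using t by (intro phi_left_mono) simp
    ultimately have "phi_left t \<in> fund" using y(2) by (auto simp: fund_def line_set_def)
    then show ?thesis using t T \<open>y < phi_left t\<close> by (intro bexI[of _ "phi_left t"]) auto
  qed
qed

lemma cantor_homeomorphic: "cantor homeomorphic (UNIV :: (nat \<Rightarrow> bool) set)"
proof -
  define c where "c n = phi_left (of_int (fst (from_nat n :: int \<times> int)) * \<theta>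
      + of_int (snd (from_nat n :: int \<times> int)))" for n
  have "fund homeomorphic (UNIV :: (nat \<Rightarrow> bool) set)"
  proof (rule homeomorphic_Cantor_space[where U = "\<lambda>n. {..c n}"])
    show "compact fund" by (rule compact_fund)
    have "phi_right 0 \<in> fund" using phi_less[of 0 1] by (simp add: fund_def line_set_def)
    then show "fund \<noteq> {}" by blast
    show "closedin (top_of_set fund) (fund \<inter> {..c n})" for n
      by (intro closedin_closed_Int) simp
    show "openin (top_of_set fund) (fund \<inter> {..c n})" for n
    proof -
      obtain i k where ik: "(from_nat n :: int \<times> int) = (i, k)" by fastforce
      \<comment> \<open>The gap to the right of \<open>c n\<close> contains no point of the set, so
        the closed cut at \<open>c n\<close> is also the open cut at the far end of that
        gap.\<close>
      have "fund \<inter> {..c n} = fund \<inter> {..<c n + l i}"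
      proof -
        have "y \<notin> line_gap i k" if "y \<in> fund" for y using that line_set_iff by (auto simp: fund_def)
        then show ?thesis using l_pos[of i] by (force simp: c_def ik line_gap_def phi_left_gap)
      qed
      then show ?thesis by (metis openin_open_Int open_lessThan)
    qed
    have sep: "\<exists>n. x \<in> {..c n} \<and> y \<notin> {..c n}" if "x \<in> fund" "y \<in> fund" and less: "x < y" for x y
    proof -
      have xy: "x \<in> line_set" "y \<in> line_set" using that by (auto simp: fund_def)
      obtain i k where ik: "x \<le> phi_left (of_int i * \<theta> + of_int k)"
        "phi_left (of_int i * \<theta> + of_int k) < y"
        by (rule fund_separated[OF xy less])
      have "c (to_nat (i, k)) = phi_left (of_int i * \<theta> + of_int k)" by (simp add: c_def)
      then show ?thesis using ik by (intro exI[of _ "to_nat (i, k)"]) simp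
    qed
    show "\<exists>n. (x \<in> {..c n}) \<noteq> (y \<in> {..c n})" if "x \<in> fund" "y \<in> fund" "x \<noteq> y" for x y
      using sep[of x y] sep[of y x] that by (cases x y rule: linorder_cases) blast+
  qed (rule fund_perfect)
  with cantor_homeomorphic_fund show ?thesis by (rule homeomorphic_trans)
qed

section \<open>Injectivity and minimality\<close>

lemma denjoy_inj: "inj denjoy"
proof (rule injI)
  fix p q assume eq: "denjoy p = denjoy q"
  define x y where "x = rep_circle p" and "y = rep_circle q"
  have pq: "p = circle_of x" "q = circle_of y" by (simp_all add: x_def y_def)
  obtain m where "lift x - lift y = of_int m"
    using eq by (auto simp: pq denjoy_circle_of circle_of_eq_iff elim: Ints_cases)
  then have "lift x = lift (y + of_int m)"
    using degree_one_add_int[of lift, OF lift_add_1, of y m] by simp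
  then have "x = y + of_int m" using strict_mono_eq[OF lift_strict_mono] by blast
  then show "p = q" by (simp add: pq)
qed

text \<open>The preimage \<open>N\<close> of \<open>M\<close> on the line is closed and fully
  invariant under \<open>lift\<close> and integer translations, so its collapse is dense. Points of
  \<open>N\<close> whose collapses approach \<open>x\<close> from below are squeezed towards
  \<open>phi_left x\<close>, those from above towards \<open>phi_right x\<close>.\<close>

lemma denjoy_minimal: "minimal_set denjoy cantor"
  unfolding minimal_set_def
proof (intro conjI allI impI)
  show "cantor \<noteq> {}" by (auto simp: cantor_def line_set_def)
  show "closed cantor" by (rule closed_cantor)
  show "denjoy ` cantor = cantor" by (rule denjoy_cantor)
  fix M assume "M \<subseteq> cantor \<and> M \<noteq> {} \<and> closed M \<and> denjoy ` M = M"
  then have M: "M \<subseteq> cantor" "M \<noteq> {}" "closed M" "denjoy ` M = M" by auto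
  define N where "N = circle_of -` M"
  have closedN: "closed N" unfolding N_def
    using M(3) continuous_on_circle_of[of UNIV] by (simp add: continuous_on_closed_vimage)
  have liftN: "lift y \<in> N \<longleftrightarrow> y \<in> N" for y
  proof -
    have "circle_of (lift y) \<in> denjoy ` M \<longleftrightarrow> circle_of y \<in> M"
      using inj_image_mem_iff[OF denjoy_inj] by (simp flip: denjoy_circle_of)
    then show ?thesis using M(4) by (simp add: N_def)
  qed
  have intN: "y + of_int k \<in> N \<longleftrightarrow> y \<in> N" for y k by (simp add: N_def)
  obtain y0 where y0: "y0 \<in> N"
    using M(2) circle_of_rep unfolding N_def by (metis all_not_in_conv vimageI2)
  have step: "\<exists>y\<in>N. collapse y = collapse y0 + of_int i * \<theta>" for i
  proof (induction i rule: int_induct[where k = 0])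
    case base
    then show ?case using y0 by auto
  next
    case (step1 i)
    then obtain y where "y \<in> N" "collapse y = collapse y0 + of_int i * \<theta>" by blast
    then show ?case
      by (intro bexI[of _ "lift y"]) (auto simp: liftN collapse_lift algebra_simps)
  next
    case (step2 i)
    then obtain y where y: "y \<in> N" "collapse y = collapse y0 + of_int i * \<theta>" by blast
    obtain z where z: "y = lift z" using lift_surj by (metis surjD)
    then have "z \<in> N" "collapse z = collapse y0 + of_int (i - 1) * \<theta>"
      using y liftN collapse_lift[of z] by (auto simp: algebra_simps)
    then show ?case by blast
  qed
  have orbit: "\<exists>y\<in>N. collapse y = collapse y0 + (of_int i * \<theta> + of_int k)" for i k
  proof -
    obtain y where y: "y \<in> N" "collapse y = collapse y0 + of_int i * \<theta>" using step by blast
    have "collapse (y + of_int k) = collapse y + of_int k"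
      using collapse_between[of y] by (intro collapse_unique) (simp_all add: phi_add_int)
    then show ?thesis using y intN by (intro bexI[of _ "y + of_int k"]) auto
  qed
  have dense: "\<exists>y\<in>N. b < collapse y \<and> collapse y < c" if "b < c" for b c
    using rotation_dense[OF that, of "collapse y0"] orbit by metis
  have left: "phi_left x \<in> N" for x
  proof -
    have "phi_left x \<in> closure N"
      unfolding closure_approachable
    proof (intro allI impI)
      fix e :: real assume "0 < e"
      then have "eventually (\<lambda>t. phi_left x - e < phi_right t) (at_left x)"
        by (intro order_tendstoD(1)[OF tendsto_phi_left]) simp
      then obtain b where b: "b < x" "\<And>t. b < t \<Longrightarrow> t < x \<Longrightarrow> phi_left x - e < phi_right t"
        by (auto simp: eventually_at_left[of "x - 1"])
      define t where "t = (b + x) / 2"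
      have t: "b < t" "t < x" using b by (auto simp: t_def)
      obtain y where y: "y \<in> N" "t < collapse y" "collapse y < x" using dense[OF t(2)] by blast
      have "phi_left x - e < y"
        using b(2)[OF t] phi_less[OF y(2)] collapse_between(1)[of y] by linarith
      moreover have "y < phi_left x" using phi_less[OF y(3)] collapse_between(2)[of y] by linarith
      ultimately show "\<exists>y\<in>N. dist y (phi_left x) < e" using y by (intro bexI[of _ y]) (auto simp: dist_real_def)
    qed
    then show ?thesis using closedN by simp
  qed
  have right: "phi_right x \<in> N" for x
  proof -
    have "phi_right x \<in> closure N"
      unfolding closure_approachable
    proof (intro allI impI)
      fix e :: real assume "0 < e"
      then have "eventually (\<lambda>t. phi_left t < phi_right x + e) (at_right x)"
        by (intro order_tendstoD(2)[OF tendsto_phi_right]) simp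
      then obtain b where b: "x < b" "\<And>t. x < t \<Longrightarrow> t < b \<Longrightarrow> phi_left t < phi_right x + e"
        by (auto simp: eventually_at_right[of _ "x + 1"])
      define t where "t = (b + x) / 2"
      have t: "x < t" "t < b" using b by (auto simp: t_def)
      obtain y where y: "y \<in> N" "x < collapse y" "collapse y < t" using dense[OF t(1)] by blast
      have "y < phi_right x + e"
        using b(2)[OF t] phi_less[OF y(3)] collapse_between(2)[of y] by linarith
      moreover have "phi_right x < y" using phi_less[OF y(2)] collapse_between(1)[of y] by linarith
      ultimately show "\<exists>y\<in>N. dist y (phi_right x) < e" using y by (intro bexI[of _ y]) (auto simp: dist_real_def)
    qed
    then show ?thesis using closedN by simp
  qed
  have "line_set \<subseteq> N" using left right by (auto simp: line_set_def)
  then have "cantor \<subseteq> M" by (auto simp: cantor_def N_def)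
  with M(1) show "M = cantor" by blast
qed

section \<open>Wandering gaps and the properties of the map\<close>

lemma denjoy_wandering: "maximal_wandering_set denjoy cantor gap"
  unfolding maximal_wandering_set_def
proof (intro conjI allI impI)
  fix i
  show "open_circle_interval (gap i)"
    unfolding open_circle_interval_def gap_def using l_pos[of i] l_less_1[of i]
    by (intro exI[of _ "gap_start i"] exI[of _ "gap_start i + l i"]) auto
  show "gap i \<subseteq> - cantor"
  proof
    fix p assume "p \<in> gap i"
    then have "circle_of (rep_circle p) \<in> gap i" by simp
    then have "rep_circle p \<notin> line_set" unfolding circle_of_in_gap using line_set_iff by blast
    then show "p \<in> - cantor" using circle_of_in_cantor[of "rep_circle p"] by simp
  qed
  show "denjoy ` gap i = gap (i + 1)" by (rule denjoy_gap)
next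
  fix i j :: int assume "i \<noteq> j"
  show "gap i \<inter> gap j = {}"
  proof (rule ccontr)
    assume "gap i \<inter> gap j \<noteq> {}"
    then obtain p where "circle_of (rep_circle p) \<in> gap i" "circle_of (rep_circle p) \<in> gap j" by auto
    then show False using \<open>i \<noteq> j\<close> line_gap_unique unfolding circle_of_in_gap by blast
  qed
next
  fix i I assume I: "circle_interval I \<and> gap i \<subset> I"
  then obtain A where A: "is_interval A" "I = circle_of ` A" by (auto simp: circle_interval_def)
  show "I \<inter> cantor \<noteq> {}"
  proof
    assume disj: "I \<inter> cantor = {}"
    have notK: "y \<notin> line_set" if "y \<in> A" for y
      using disj that A(2) circle_of_in_cantor by blast
    \<comment> \<open>The interval \<open>A\<close> may represent \<open>I\<close> at any integer
      translate; the midpoint of the gap shows which translate of the gap it meets.\<close>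
    have "circle_of (gap_start i + l i / 2) \<in> I"
      using I l_pos[of i] by (force simp: gap_def)
    then obtain y where y: "y \<in> A" "circle_of y = circle_of (gap_start i + l i / 2)"
      using A(2) by force
    then have "circle_of y \<in> gap i" using l_pos[of i] by (auto simp: gap_def)
    then obtain k where k: "y \<in> line_gap i k" using circle_of_in_gap by blast
    \<comment> \<open>Leaving the gap within an interval means containing one of its ends, and both
      ends lie in \<open>line_set\<close>.\<close>
    have "z \<in> line_gap i k" if z: "z \<in> A" for z
    proof (rule ccontr)
      assume no: "z \<notin> line_gap i k"
      let ?a = "phi_left (of_int i * \<theta> + of_int k)" and ?b = "phi_right (of_int i * \<theta> + of_int k)"
      have "z \<le> ?a \<or> ?b \<le> z" "?a \<le> y" "y \<le> ?b" using no k by (auto simp: line_gap_eq)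
      then have "?a \<in> A \<or> ?b \<in> A"
        using mem_is_interval_1_I[OF A(1) z y(1)] mem_is_interval_1_I[OF A(1) y(1) z] by blast
      moreover have "?a \<in> line_set" "?b \<in> line_set" by (auto simp: line_set_def)
      ultimately show False using notK by blast
    qed
    then have "I \<subseteq> gap i" using A(2) circle_of_in_gap by blast
    with I show False by blast
  qed
qed

lemma circle_length_gap: "circle_length (gap i) = l i"
  unfolding gap_def using l_pos[of i] l_less_1[of i] by (subst circle_length_interval) auto

lemma denjoy_lift_of: "lift_of lift denjoy"
  unfolding denjoy_def by (rule lift_of_circle_map[of lift, OF lift_add_1 lift_continuous])

lemma denjoy_rotation_number: "has_rotation_number denjoy \<theta>"
  unfolding has_rotation_number_def using denjoy_lift_of lift_strict_mono lift_rotation by blast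

lemma denjoy_exceptional_minimal_set: "exceptional_minimal_set denjoy cantor"
  by (simp add: exceptional_minimal_set_def denjoy_minimal cantor_homeomorphic)

lemma denjoy_exceptional: "exceptional denjoy"
  unfolding exceptional_def using denjoy_rotation_number irrational denjoy_exceptional_minimal_set
  by blast

lemma denjoy_Diff:
  assumes "concave_modulus \<alpha>" "\<And>i. \<bar>l (i + 1) / l i - 1\<bar> \<le> C * \<alpha> (l i)"
  shows "denjoy \<in> Diff_plus_1 \<alpha>"
  unfolding denjoy_def
proof (rule circle_diffeo[of lift slope])
  show "0 < slope x" for x using slope_ge[of x] by linarith
  show "alpha_continuous \<alpha> (circle_fun slope)"
    using slope_add_1 slope_holder[OF assms] by (rule alpha_continuous_circle_fun[OF assms(1)])
qed (rule lift_add_1 slope_add_1 has_derivative_lift slope_continuous lift_strict_mono lift_surj)+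

lemma gap_length_ratio:
  "((\<lambda>i::int. circle_length (gap (i + 1)) / circle_length (gap i)) \<longlongrightarrow> 1) at_top"
proof (rule tendstoI)
  fix e :: real assume "0 < e"
  then have fin: "finite {i. e \<le> \<bar>l (i + 1) / l i - 1\<bar>}" by (rule l_ratio_finite)
  obtain b where b: "\<And>i. i \<in> {i. e \<le> \<bar>l (i + 1) / l i - 1\<bar>} \<Longrightarrow> i \<le> b"
    using bdd_above_finite[OF fin] unfolding bdd_above_def by blast
  show "eventually (\<lambda>i. dist (circle_length (gap (i + 1)) / circle_length (gap i)) 1 < e) at_top"
    using eventually_gt_at_top[of b]
  proof eventually_elim
    case (elim i)
    then show ?case using b[of i] by (force simp: circle_length_gap dist_real_def)
  qed
qed

end

theorem theorem1p8:
  fixes \<theta> :: real and \<alpha> :: "real \<Rightarrow> real"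
  assumes "\<theta> \<notin> \<rat>"
    and "concave_modulus \<alpha>"
    and "\<And>t. t > 0 \<Longrightarrow> \<alpha> differentiable (at t)"
    and "(\<integral>\<^sup>+ t\<in>{0<..1}. ennreal (modulus_inv \<alpha> t / t\<^sup>2) \<partial>lborel) < \<infinity>"
    and "bdd_above ((\<lambda>t. \<alpha> t / (t * deriv \<alpha> t)) ` {0<..})"
  shows "\<exists>f \<in> Diff_plus_1 \<alpha>. exceptional f \<and> has_rotation_number f \<theta> \<and>
    (\<exists>K J. exceptional_minimal_set f K \<and> maximal_wandering_set f K J \<and>
      ((\<lambda>i::int. circle_length (J (i + 1)) / circle_length (J i)) \<longlongrightarrow> 1) at_top)"
proof -
  obtain l :: "int \<Rightarrow> real" and C where l: "\<And>i. 0 < l i" "l summable_on UNIV" "infsum l UNIV < 1"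
    "\<And>i. \<bar>l (i + 1) / l i - 1\<bar> \<le> 1 / 3"
    "\<And>i. \<bar>l (i + 1) / l i - 1\<bar> \<le> C * \<alpha> (l i)"
    "\<And>e. 0 < e \<Longrightarrow> finite {i. e \<le> \<bar>l (i + 1) / l i - 1\<bar>}"
    by (rule exists_gap_lengths[OF assms(2-5)]) (assumption, rule that)
  interpret gap_lengths \<theta> l
    using assms(1) l by unfold_locales
  show ?thesis
    using denjoy_Diff[OF assms(2) l(5)] denjoy_exceptional denjoy_rotation_number
      denjoy_exceptional_minimal_set denjoy_wandering gap_length_ratio by blast
qed

end
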